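(* Every $(C_4,K_{1,2})$-co-critical graph on $n\ge 5$ vertices has at least $2n-3$ edges. Moreover, this bound is sharp: for every integer $n\ge 5$ there exists a $(C_4,K_{1,2})$-co-critical graph on $n$ vertices with exactly $2n-3$ edges.
   Context: All graphs are finite, simple, without loops or multiple edges. For a graph $G$, a $\{\text{red},\text{blue}\}$-coloring of $E(G)$ is a critical coloring if $G$ contains neither a red copy of $C_4$ (the cycle on 4 vertices, as a not necessarily induced subgraph) nor a blue copy of $K_{1,2}$ (a path with 2 edges). A non-complete graph $G$ is $(C_4,K_{1,2})$-co-critical if $G$ admits a critical coloring, but for every edge $e$ of the complement of $G$, the graph $G+e$ (obtained by adding $e$) admits no critical coloring. *)

theory Defs
  imports Main
begin

text \<open>A graph is a pair of a vertex set and an edge set, an edge being a two-element set of vertices.\<close>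

type_synonym 'a graph = "'a set \<times> 'a set set"

definition verts :: "'a graph \<Rightarrow> 'a set" where
  "verts G = fst G"

definition edges :: "'a graph \<Rightarrow> 'a set set" where
  "edges G = snd G"

definition all_pairs :: "'a set \<Rightarrow> 'a set set" where
  "all_pairs V = {e. e \<subseteq> V \<and> card e = 2}"

definition simple_graph :: "'a graph \<Rightarrow> bool" where
  "simple_graph G \<longleftrightarrow> finite (verts G) \<and> edges G \<subseteq> all_pairs (verts G)"

definition complete_graph :: "'a graph \<Rightarrow> bool" where
  "complete_graph G \<longleftrightarrow> simple_graph G \<and> edges G = all_pairs (verts G)"

definition complement_graph :: "'a graph \<Rightarrow> 'a graph" where
  "complement_graph G = (verts G, all_pairs (verts G) - edges G)"

definition add_edge :: "'a graph \<Rightarrow> 'a set \<Rightarrow> 'a graph" where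
  "add_edge G e = (verts G, insert e (edges G))"

text \<open>Copies are subgraphs, not necessarily induced: non-edges of \<open>H\<close> may be mapped to edges.\<close>

definition contains_copy :: "'a graph \<Rightarrow> 'b graph \<Rightarrow> bool" where
  "contains_copy G H \<longleftrightarrow>
     (\<exists>f. inj_on f (verts H) \<and> f ` verts H \<subseteq> verts G \<and> (\<forall>e \<in> edges H. f ` e \<in> edges G))"

definition C4 :: "nat graph" where
  "C4 = ({0, 1, 2, 3}, {{0, 1}, {1, 2}, {2, 3}, {3, 0}})"

definition K12 :: "nat graph" where
  "K12 = ({0, 1, 2}, {{0, 1}, {0, 2}})"

datatype colour = Red | Blue

text \<open>A colouring is a total function on sets; only its values on the edges of \<open>G\<close> matter.\<close>

definition colour_class :: "'a graph \<Rightarrow> ('a set \<Rightarrow> colour) \<Rightarrow> colour \<Rightarrow> 'a graph" where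
  "colour_class G c k = (verts G, {e \<in> edges G. c e = k})"

definition critical_colouring ::
    "'b graph \<Rightarrow> 'c graph \<Rightarrow> 'a graph \<Rightarrow> ('a set \<Rightarrow> colour) \<Rightarrow> bool" where
  "critical_colouring H1 H2 G c \<longleftrightarrow>
     \<not> contains_copy (colour_class G c Red) H1 \<and> \<not> contains_copy (colour_class G c Blue) H2"

definition co_critical :: "'b graph \<Rightarrow> 'c graph \<Rightarrow> 'a graph \<Rightarrow> bool" where
  "co_critical H1 H2 G \<longleftrightarrow>
     simple_graph G \<and> \<not> complete_graph G \<and>
     (\<exists>c. critical_colouring H1 H2 G c) \<and>
     (\<forall>e \<in> edges (complement_graph G). \<not> (\<exists>c. critical_colouring H1 H2 (add_edge G e) c))"

end

theory Submission
  imports Defs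
begin

text \<open>
  Lower bound. Take a critical colouring with as few blue edges as possible, let \<open>r\<close> be its red graph
  and \<open>U\<close> the set of vertices missed by the blue matching. Since a non-edge of \<open>G\<close> cannot be added in
  red, and a blue edge cannot be recoloured, any two vertices that are not joined in red are joined
  by a red path with three edges, so the red graph is \<open>C\<^sub>4\<close>-saturated; since a non-edge cannot be
  added in blue, \<open>U\<close> is a red clique and has at most three vertices. As \<open>G\<close> has \<open>(n - |U|) / 2\<close> blue
  edges, it remains to show that the red degrees sum to at least \<open>3n - 7 + |U|\<close>. This is an
  Ollmann-type bound, obtained by counting along the distance levels around a vertex of red degree one
  or two. The last unit that is needed when \<open>U\<close> has two or three vertices comes from recolouring an
  edge of \<open>U\<close> blue: the colouring stays critical, so the red paths above can be chosen to avoid that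
  edge.

  Sharpness. For \<open>n \<ge> 7\<close> join a vertex to all vertices of the disjoint union of a path on two or
  three vertices and an even cycle. For \<open>n = 5\<close> take \<open>K\<^sub>2\<close> joined to three isolated vertices, and for
  \<open>n = 6\<close> a triangle with another triangle glued to each of its edges.
\<close>

section \<open>Critical colourings in terms of adjacency\<close>

text \<open>Consecutive vertices of the cycle differ because edges are two-element sets, so
  injectivity of a copy reduces to the two diagonals.\<close>

lemma contains_copy_C4_iff:
  assumes "E \<subseteq> all_pairs V"
  shows "contains_copy (V, E) C4 \<longleftrightarrow>
    (\<exists>a b c d. a \<noteq> c \<and> b \<noteq> d \<and> {a, b} \<in> E \<and> {b, c} \<in> E \<and> {c, d} \<in> E \<and> {d, a} \<in> E)"
proof
  assume "contains_copy (V, E) C4"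
  then obtain f where f: "inj_on f {0, 1, 2, 3::nat}"
    "\<forall>e \<in> {{0, 1}, {1, 2}, {2, 3}, {3, 0::nat}}. f ` e \<in> E"
    by (auto simp: contains_copy_def C4_def verts_def edges_def)
  have "f 0 \<noteq> f 2" "f 1 \<noteq> f 3" using f(1) by (auto simp: inj_on_def)
  moreover have "{f 0, f 1} \<in> E" "{f 1, f 2} \<in> E" "{f 2, f 3} \<in> E" "{f 3, f 0} \<in> E"
    using f(2) by auto
  ultimately show "\<exists>a b c d. a \<noteq> c \<and> b \<noteq> d \<and> {a, b} \<in> E \<and> {b, c} \<in> E \<and> {c, d} \<in> E \<and> {d, a} \<in> E"
    by blast
next
  assume "\<exists>a b c d. a \<noteq> c \<and> b \<noteq> d \<and> {a, b} \<in> E \<and> {b, c} \<in> E \<and> {c, d} \<in> E \<and> {d, a} \<in> E"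
  then obtain a b c d where h: "a \<noteq> c" "b \<noteq> d" "{a, b} \<in> E" "{b, c} \<in> E" "{c, d} \<in> E" "{d, a} \<in> E"
    by blast
  have pair: "x \<noteq> y \<and> x \<in> V \<and> y \<in> V" if "{x, y} \<in> E" for x y
    using that assms by (force simp: all_pairs_def card_insert_if split: if_splits)
  note p = pair[OF h(3)] pair[OF h(4)] pair[OF h(5)] pair[OF h(6)]
  let ?f = "\<lambda>i::nat. if i = 0 then a else if i = 1 then b else if i = 2 then c else d"
  show "contains_copy (V, E) C4"
    unfolding contains_copy_def C4_def verts_def edges_def
    by (rule exI[of _ ?f]) (use h p in \<open>auto simp: inj_on_def insert_commute\<close>)
qed

lemma contains_copy_K12_iff:
  assumes "E \<subseteq> all_pairs V"
  shows "contains_copy (V, E) K12 \<longleftrightarrow> (\<exists>a b c. b \<noteq> c \<and> {a, b} \<in> E \<and> {a, c} \<in> E)"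
proof
  assume "contains_copy (V, E) K12"
  then obtain f where f: "inj_on f {0, 1, 2::nat}" "\<forall>e \<in> {{0, 1}, {0, 2::nat}}. f ` e \<in> E"
    by (auto simp: contains_copy_def K12_def verts_def edges_def)
  have "f 1 \<noteq> f 2" using f(1) by (auto simp: inj_on_def)
  moreover have "{f 0, f 1} \<in> E" "{f 0, f 2} \<in> E" using f(2) by auto
  ultimately show "\<exists>a b c. b \<noteq> c \<and> {a, b} \<in> E \<and> {a, c} \<in> E" by blast
next
  assume "\<exists>a b c. b \<noteq> c \<and> {a, b} \<in> E \<and> {a, c} \<in> E"
  then obtain a b c where h: "b \<noteq> c" "{a, b} \<in> E" "{a, c} \<in> E" by blast
  have pair: "x \<noteq> y \<and> x \<in> V \<and> y \<in> V" if "{x, y} \<in> E" for x y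
    using that assms by (force simp: all_pairs_def card_insert_if split: if_splits)
  note p = pair[OF h(2)] pair[OF h(3)]
  let ?f = "\<lambda>i::nat. if i = 0 then a else if i = 1 then b else c"
  show "contains_copy (V, E) K12"
    unfolding contains_copy_def K12_def verts_def edges_def
    by (rule exI[of _ ?f]) (use h p in \<open>auto simp: inj_on_def insert_commute\<close>)
qed

lemma pair_in_all_pairs: "{x, y} \<in> all_pairs V \<longleftrightarrow> x \<noteq> y \<and> x \<in> V \<and> y \<in> V"
  by (auto simp: all_pairs_def card_insert_if)

lemma critical_colouring_C4_K12_iff:
  assumes "E \<subseteq> all_pairs V"
  shows "critical_colouring C4 K12 (V, E) col \<longleftrightarrow>
    (\<forall>a b c d. {a, b} \<in> E \<and> col {a, b} = Red \<longrightarrow> {b, c} \<in> E \<and> col {b, c} = Red \<longrightarrow>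
       {c, d} \<in> E \<and> col {c, d} = Red \<longrightarrow> {d, a} \<in> E \<and> col {d, a} = Red \<longrightarrow> a = c \<or> b = d) \<and>
    (\<forall>a b c. {a, b} \<in> E \<and> col {a, b} = Blue \<longrightarrow> {a, c} \<in> E \<and> col {a, c} = Blue \<longrightarrow> b = c)"
proof -
  have *: "{e \<in> E. P e} \<subseteq> all_pairs V" for P using assms by auto
  show ?thesis
    unfolding critical_colouring_def colour_class_def verts_def edges_def fst_conv snd_conv
      contains_copy_C4_iff[OF *] contains_copy_K12_iff[OF *] by blast
qed

lemma sum_degrees:
  assumes "finite V" "E \<subseteq> all_pairs V"
  shows "(\<Sum>x\<in>V. card {y. {x, y} \<in> E}) = 2 * card E"
proof -
  have finE: "finite E"
    using assms by (auto intro!: finite_subset[OF assms(2)] finite_subset[of "all_pairs V" "Pow V"] simp: all_pairs_def)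
  have fin: "finite {y. {x, y} \<in> E}" for x
    by (rule finite_subset[OF _ assms(1)]) (use assms(2) in \<open>auto simp: all_pairs_def\<close>)
  have "(\<Sum>x\<in>V. card {y. {x, y} \<in> E}) = (\<Sum>x\<in>V. card {e \<in> E. x \<in> e})"
  proof (rule sum.cong[OF refl])
    fix x
    have "{e \<in> E. x \<in> e} = (\<lambda>y. {x, y}) ` {y. {x, y} \<in> E}"
    proof -
      have "e \<in> (\<lambda>y. {x, y}) ` {y. {x, y} \<in> E}" if eE: "e \<in> E" "x \<in> e" for e
      proof -
        obtain u w where "e = {u, w}" using eE(1) assms(2) by (fastforce simp: all_pairs_def card_2_iff)
        then show ?thesis using eE by (auto simp: insert_commute)
      qed
      then show ?thesis by auto
    qed
    moreover have "inj_on (\<lambda>y. {x, y}) {y. {x, y} \<in> E}" by (auto simp: inj_on_def doubleton_eq_iff)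
    ultimately show "card {y. {x, y} \<in> E} = card {e \<in> E. x \<in> e}" by (simp add: card_image)
  qed
  also have "\<dots> = 2 * card E"
  proof (rule sum_multicount[OF assms(1) finE], intro ballI)
    fix e assume "e \<in> E"
    then have "{x \<in> V. x \<in> e} = e" "card e = 2" using assms(2) by (auto simp: all_pairs_def)
    then show "card {x \<in> V. x \<in> e} = 2" by simp
  qed
  finally show ?thesis .
qed

section \<open>The red graph of a critical colouring\<close>

text \<open>
  Assumption \<open>U_switch\<close> reflects that the colouring stays critical when the edge \<open>uw\<close> is recoloured
  blue.
\<close>
locale red_blue =
  fixes V :: "'a set" and r b :: "'a \<Rightarrow> 'a \<Rightarrow> bool" and U :: "'a set"
  assumes finite_V: "finite V"
    and r_irrefl: "\<not> r x x"
    and r_sym: "r x y \<Longrightarrow> r y x"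
    and r_V: "r x y \<Longrightarrow> x \<in> V"
    and C4_free: "r p q \<Longrightarrow> r q s \<Longrightarrow> r s t \<Longrightarrow> r t p \<Longrightarrow> p = s \<or> q = t"
    and saturated: "p \<in> V \<Longrightarrow> q \<in> V \<Longrightarrow> p \<noteq> q \<Longrightarrow> \<not> r p q \<Longrightarrow>
      \<exists>s t. r p s \<and> r s t \<and> r t q \<and> s \<noteq> q \<and> t \<noteq> p"
    and b_unique: "b x y \<Longrightarrow> b x z \<Longrightarrow> y = z"
    and b_sym: "b x y \<Longrightarrow> b y x"
    and U_V: "U \<subseteq> V"
    and U_unmatched: "u \<in> U \<Longrightarrow> \<not> b u x"
    and U_clique: "u \<in> U \<Longrightarrow> w \<in> U \<Longrightarrow> u \<noteq> w \<Longrightarrow> r u w"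
    and U_switch: "u \<in> U \<Longrightarrow> w \<in> U \<Longrightarrow> u \<noteq> w \<Longrightarrow>
      p \<in> V \<Longrightarrow> q \<in> V \<Longrightarrow> p \<noteq> q \<Longrightarrow> \<not> r p q \<Longrightarrow> \<not> b p q \<Longrightarrow>
      \<exists>s t. r p s \<and> r s t \<and> r t q \<and> s \<noteq> q \<and> t \<noteq> p \<and>
        {p, s} \<noteq> {u, w} \<and> {s, t} \<noteq> {u, w} \<and> {t, q} \<noteq> {u, w}"
    and card_V: "card V \<ge> 3"
begin

definition N :: "'a \<Rightarrow> 'a set" where "N x = {y. r x y}"

lemma in_N [simp]: "y \<in> N x \<longleftrightarrow> r x y" by (simp add: N_def)

lemma r_comm: "r x y \<longleftrightarrow> r y x" using r_sym by blast

lemma r_V2: "r x y \<Longrightarrow> y \<in> V" using r_V r_sym by blast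

lemma N_subset: "N x \<subseteq> V" using r_V2 by auto

lemma finite_N [simp]: "finite (N x)" using N_subset finite_V finite_subset by blast

text \<open>The working form of \<open>C4_free\<close>: two common neighbours of \<open>x\<close>
  and \<open>y\<close> would close a red 4-cycle. Nearly every uniqueness argument below is an
  instance.\<close>

lemma common_nbr_unique: "r x p \<Longrightarrow> r y p \<Longrightarrow> r x q \<Longrightarrow> r y q \<Longrightarrow> x \<noteq> y \<Longrightarrow> p = q"
  using C4_free[of x p y q] r_sym by blast

text \<open>Edges inside \<open>S \<inter> T\<close> are counted twice.\<close>
definition e :: "'a set \<Rightarrow> 'a set \<Rightarrow> nat" where "e S T = (\<Sum>x\<in>S. card (N x \<inter> T))"

section \<open>Double counting of red edges between vertex sets\<close>

lemma e_sym: assumes "finite S" "finite T" shows "e S T = e T S"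
proof -
  have "e S T = (\<Sum>x\<in>S. card {y \<in> T. r x y})" unfolding e_def
    by (intro sum.cong refl arg_cong[where f = card]) auto
  also have "\<dots> = (\<Sum>y\<in>T. card {x \<in> S. r x y})"
    by (rule sum_multicount_gen[OF assms]) simp
  also have "\<dots> = e T S" unfolding e_def
    by (intro sum.cong refl arg_cong[where f = card]) (auto simp: r_comm)
  finally show ?thesis .
qed

lemma card_N_Un:
  assumes "S \<inter> T = {}" shows "card (N x \<inter> (S \<union> T)) = card (N x \<inter> S) + card (N x \<inter> T)"
  unfolding Int_Un_distrib by (rule card_Un_disjoint) (use assms in auto)

lemma e_Un_left: "finite S \<Longrightarrow> finite T \<Longrightarrow> S \<inter> T = {} \<Longrightarrow> e (S \<union> T) X = e S X + e T X"
  unfolding e_def by (rule sum.union_disjoint)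

lemma e_Un_right: "S \<inter> T = {} \<Longrightarrow> e X (S \<union> T) = e X S + e X T"
  unfolding e_def card_N_Un sum.distrib by (simp add: card_N_Un sum.distrib)

lemma e_Un_both:
  assumes "finite S" "finite T" "S \<inter> T = {}"
  shows "e (S \<union> T) (S \<union> T) = e S S + 2 * e S T + e T T"
  using assms e_sym[of S T] by (simp add: e_Un_left e_Un_right)

lemma degree_sum: "e V V = (\<Sum>x\<in>V. card (N x))"
  unfolding e_def by (intro sum.cong refl arg_cong[where f = card]) (use N_subset in auto)

lemma e_card: assumes "\<And>x. x \<in> S \<Longrightarrow> card (N x \<inter> T) = k" shows "e S T = k * card S"
  unfolding e_def using assms by simp

lemma N_nonempty: assumes "x \<in> V" shows "N x \<noteq> {}"
proof -
  have "\<exists>y\<in>V. y \<noteq> x"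
  proof (rule ccontr)
    assume "\<not> ?thesis"
    then have "V \<subseteq> {x}" by auto
    then have "card V \<le> card {x}" by (intro card_mono) auto
    then show False using card_V by simp
  qed
  then obtain y where "y \<in> V" "y \<noteq> x" by blast
  then show ?thesis using saturated[of x y] assms by (cases "r x y") auto
qed

end

section \<open>A vertex of red degree one\<close>

locale red_leaf = red_blue +
  fixes x s
  assumes leaf: "N x = {s}"
begin

abbreviation "N1 \<equiv> N s"
text \<open>By \<open>N2_parent\<close> these vertices are at distance exactly two from the support
  \<open>s\<close>, so \<open>{s}\<close>, \<open>N1\<close> and \<open>N2\<close> are the distance
  levels around \<open>s\<close>; the leaf \<open>x\<close> lies in \<open>N1\<close>.\<close>

definition "N2 = V - {s} - N s"

lemma x_s: "r x s" "r s x" "x \<noteq> s" "x \<in> V" "s \<in> V"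
proof -
  show "r x s" using leaf in_N by blast
  then show "r s x" "x \<noteq> s" "x \<in> V" "s \<in> V" using r_sym r_irrefl r_V r_V2 by auto
qed

lemma from_x: "r x y \<longleftrightarrow> y = s" using leaf in_N by blast

text \<open>A red path with three edges that starts at the leaf \<open>x\<close> has
  \<open>s\<close> as its second vertex; dropping its first edge leaves a path with two edges from
  \<open>s\<close>.\<close>

lemma path_from_s: assumes "y \<in> V" "y \<noteq> x" "y \<noteq> s" shows "\<exists>c. r s c \<and> r c y \<and> c \<noteq> x"
proof -
  have "\<not> r x y" using from_x[of y] assms by simp
  then obtain c d where "r x c" "r c d" "r d y" "d \<noteq> x"
    using saturated[OF x_s(4) assms(1)] assms by blast
  then show ?thesis using from_x[of c] by blast
qed

text \<open>Existence is \<open>path_from_s\<close>; a second neighbour in \<open>N1\<close> would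
  be a second common neighbour of \<open>w\<close> and \<open>s\<close>. Hence the red edges inside
  \<open>N1\<close> form a perfect matching of \<open>N1 - {x}\<close>. \<open>N2_parent\<close>
  uses the same argument.\<close>

lemma N1_partner: assumes "w \<in> N1" "w \<noteq> x" shows "card (N w \<inter> N1) = 1"
proof -
  have w: "r s w" "w \<in> V" "w \<noteq> s" using assms r_V2[of s w] r_irrefl[of s] by auto
  then obtain c where c: "r s c" "r c w" using path_from_s[OF w(2) assms(2)] by blast
  have "r w d \<and> r s d \<longleftrightarrow> d = c" for d
    using common_nbr_unique[OF _ _ c(1) r_sym[OF c(2)], of d] w(3) c r_sym[OF c(2)] by blast
  then have "N w \<inter> N1 = {c}" by (simp add: set_eq_iff)
  then show ?thesis by simp
qed

lemma N2_parent: assumes "y \<in> N2" shows "card (N y \<inter> N1) = 1"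
proof -
  have y: "y \<in> V" "y \<noteq> s" "\<not> r s y" using assms unfolding N2_def by auto
  have "y \<noteq> x" using y(3) x_s(2) by blast
  then obtain c where c: "r s c" "r c y" using path_from_s[OF y(1)] y(2) by blast
  have "r y d \<and> r s d \<longleftrightarrow> d = c" for d
    using common_nbr_unique[OF _ _ c(1) r_sym[OF c(2)], of d] y(2) c r_sym[OF c(2)] by blast
  then have "N y \<inter> N1 = {c}" by (simp add: set_eq_iff)
  then show ?thesis by simp
qed

lemma V_split: "V = {s} \<union> (N1 \<union> N2)" "s \<notin> N1" "s \<notin> N2" "N1 \<inter> N2 = {}" "finite N2"
  using x_s N_subset r_irrefl finite_V unfolding N2_def by auto

text \<open>The degree of \<open>s\<close>, the matching on \<open>N1 - {x}\<close> and the unique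
  parents of \<open>N2\<close> fix every contribution except that of the edges inside
  \<open>N2\<close>, so only those remain to be bounded.\<close>

lemma degree_sum_leaf: "e V V + 4 + card N2 = 3 * card V + (\<Sum>y\<in>N2. card (N y \<inter> N2))"
proof -
  let ?d = "card N1"
  have d: "?d \<ge> 1" using x_s card_gt_0_iff[of N1] by (force simp: Suc_le_eq)
  have V: "card V = 1 + (?d + card N2)"
  proof -
    have "card V = card ({s} \<union> (N1 \<union> N2))" using V_split(1) by (rule arg_cong)
    also have "\<dots> = 1 + card (N1 \<union> N2)" using V_split(2-5) by simp
    also have "card (N1 \<union> N2) = ?d + card N2" using V_split(4,5) by (simp add: card_Un_disjoint)
    finally show ?thesis .
  qed
  have "e V V = e {s} {s} + 2 * e {s} (N1 \<union> N2) + e (N1 \<union> N2) (N1 \<union> N2)"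
    using e_Un_both[of "{s}" "N1 \<union> N2"] V_split by simp
  also have "e {s} {s} = 0" using r_irrefl by (simp add: e_def)
  also have "e {s} (N1 \<union> N2) = ?d" using V_split by (simp add: e_def Int_Un_distrib)
  also have "e (N1 \<union> N2) (N1 \<union> N2) = e N1 N1 + 2 * e N2 N1 + e N2 N2"
    using e_Un_both[of N1 N2] V_split e_sym[of N1 N2] by simp
  also have "e N2 N1 = card N2" using e_card[of N2 N1 1] N2_parent by simp
  also have "e N1 N1 = ?d - 1"
  proof -
    have "e N1 N1 = e ({x} \<union> (N1 - {x})) N1" using x_s by (simp add: insert_absorb)
    also have "\<dots> = e {x} N1 + e (N1 - {x}) N1" by (rule e_Un_left) auto
    also have "e {x} N1 = 0" using leaf V_split(2) by (simp add: e_def)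
    also have "e (N1 - {x}) N1 = card (N1 - {x})"
      using e_card[of "N1 - {x}" N1 1] N1_partner by simp
    finally show ?thesis using x_s by simp
  qed
  finally show ?thesis using V d unfolding e_def by simp
qed

section \<open>Further red leaves, and their interplay with the unmatched set\<close>

definition "Z = {y \<in> N2. N y \<inter> N2 = {}}"

text \<open>Thus \<open>Z\<close> consists of the red leaves in \<open>N2\<close>, the only vertices
  of \<open>N2\<close> that contribute nothing to the sum left open in
  \<open>degree_sum_leaf\<close>.\<close>

lemma Z_nbr: assumes "y \<in> Z" obtains p where "N y = {p}" "r s p"
proof -
  have y: "y \<in> N2" "N y \<inter> N2 = {}" using assms unfolding Z_def by blast+
  obtain p where p: "N y \<inter> N1 = {p}" by (rule card_1_singletonE[OF N2_parent[OF y(1)]])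
  have "s \<notin> N y" using y(1) r_comm[of y s] by (simp add: N2_def)
  then have "N y \<subseteq> N1" using y(2) N_subset[of y] unfolding N2_def by blast
  with p have "N y = {p}" by blast
  moreover from p have "p \<in> N1" by blast
  ultimately show thesis using that by simp
qed

text \<open>The red path with three edges between two leaves has their supports as its inner
  vertices.\<close>

lemma Z_supports:
  assumes "y \<in> Z" "z \<in> Z" "y \<noteq> z" "N y = {p}" "N z = {q}" shows "r p q"
proof -
  have p: "r y c \<longleftrightarrow> c = p" for c using assms(4) in_N[of c y] by simp
  have q: "r z c \<longleftrightarrow> c = q" for c using assms(5) in_N[of c z] by simp
  have "z \<notin> N y" "y \<in> V" "z \<in> V" using assms(1,2) by (auto simp: Z_def N2_def)
  then obtain c d where "r y c" "r c d" "r d z"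
    using saturated[of y z] assms(3) by auto
  then show ?thesis using p[of c] q[of d] r_sym[of d z] by simp
qed

lemma N1_nbr_unique: "r s w \<Longrightarrow> r w p \<Longrightarrow> r w q \<Longrightarrow> r s p \<Longrightarrow> r s q \<Longrightarrow> p = q"
  using common_nbr_unique[of s p w q] r_irrefl[of s] by blast

text \<open>Three leaves in \<open>Z\<close> would have pairwise adjacent supports in
  \<open>N1\<close>, but a vertex of \<open>N1\<close> has at most one neighbour in
  \<open>N1\<close>.\<close>

lemma card_Z: "card Z \<le> 2"
proof (rule ccontr)
  assume "\<not> ?thesis"
  then obtain T where "T \<subseteq> Z" "card T = 3" using obtain_subset_with_card_n[of 3 Z] by auto
  then obtain y1 y2 y3 where y: "y1 \<in> Z" "y2 \<in> Z" "y3 \<in> Z" "y1 \<noteq> y2" "y1 \<noteq> y3" "y2 \<noteq> y3"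
    by (auto simp: card_3_iff)
  obtain p1 where p1: "N y1 = {p1}" "r s p1" using Z_nbr[OF y(1)] .
  obtain p2 where p2: "N y2 = {p2}" "r s p2" using Z_nbr[OF y(2)] .
  obtain p3 where p3: "N y3 = {p3}" "r s p3" using Z_nbr[OF y(3)] .
  have "r p1 p2" "r p1 p3" "r p2 p3"
    using Z_supports[OF y(1,2,4) p1(1) p2(1)] Z_supports[OF y(1,3,5) p1(1) p3(1)]
      Z_supports[OF y(2,3,6) p2(1) p3(1)] by auto
  then show False using N1_nbr_unique[of p1 p2 p3] p1(2) p2(2) p3(2) r_irrefl[of p2] by blast
qed

text \<open>
  If \<open>u \<notin> N2\<close>, switching the edge \<open>uw\<close> would destroy the only red path with three edges between
  the leaf \<open>x\<close> and some vertex, except when \<open>u\<close> or \<open>w\<close> is the support \<open>s\<close>, where the second leaf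
  \<open>y\<close> is needed.
\<close>
lemma U_N2:
  assumes "y \<in> Z" "u \<in> U" "w \<in> U" "u \<noteq> w" shows "u \<in> N2"
proof (rule ccontr)
  assume u: "u \<notin> N2"
  have uw: "r u w" "r w u" "u \<in> V" "w \<in> V" using assms U_clique r_sym r_V by blast+
  have y: "y \<in> V" "y \<noteq> s" "\<not> r s y" "y \<noteq> x" using assms(1) x_s by (auto simp: Z_def N2_def)
  obtain p where p: "N y = {p}" "r s p" using Z_nbr[OF assms(1)] .
  note switch = U_switch[OF assms(2-4)]
  \<comment> \<open>The only red path with three edges from \<open>x\<close> to \<open>w'\<close> is
    \<open>x, s, u', w'\<close>, and its last edge is the switched one.\<close>
  have no_N1: False if h: "{u', w'} = {u, w}" "r s u'" "w' \<noteq> s" "w' \<noteq> x" for u' w'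
  proof -
    have h': "r u' w'" "w' \<in> V" "w' \<in> U" using h(1) uw assms by (auto simp: doubleton_eq_iff)
    have "\<not> r x w'" "\<not> b x w'" using from_x h U_unmatched[OF h'(3)] b_sym by blast+
    then obtain c d where cd: "r x c" "r c d" "r d w'" "{d, w'} \<noteq> {u, w}"
      using switch[of x w'] h' h(4) x_s(4) by metis
    then have "c = s" using from_x by simp
    then have "d = u'" using cd h h' common_nbr_unique[of s d w' u'] r_sym by metis
    then show False using cd h(1) by simp
  qed
  have no_s: False if h: "{s, w'} = {u, w}" for w'
  proof -
    have h': "r s w'" "r w' s" "w' \<in> U" "s \<in> U" using h uw assms by (auto simp: doubleton_eq_iff)
    show False
    proof (cases "w' = x")
      case True
      then have "\<not> b x y" using h' U_unmatched by blast
      then obtain c d where cd: "r x c" "{x, c} \<noteq> {u, w}"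
        using switch[of x y] x_s y from_x by metis
      then have "c = s" using from_x by blast
      then show False using cd(2) h True by auto
    next
      case False
      then obtain w2 where w2: "N w' \<inter> N1 = {w2}"
        using N1_partner[of w'] h'(1) by (meson card_1_singletonE in_N)
      then have w2': "r w' w2" "r s w2" by auto
      have w2x: "w2 \<noteq> x" using w2' from_x h' r_comm r_irrefl by metis
      \<comment> \<open>The only red path with three edges from \<open>x\<close> to \<open>z\<close>
        is \<open>x, s, w', z\<close>, which uses the switched edge \<open>s w'\<close>; so the pair
        \<open>x z\<close> must be blue. As \<open>x\<close> has at most one blue neighbour,
        \<open>w'\<close> has no red neighbours besides \<open>s\<close> and
        \<open>w2\<close>.\<close>
      have bx: "b x z" if z: "z \<in> V" "r w' z" "z \<noteq> s" for z
      proof (rule ccontr)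
        assume "\<not> b x z"
        moreover have "z \<noteq> x" using z from_x r_comm False h' r_irrefl by metis
        ultimately obtain c d where cd: "r x c" "r c d" "r d z" "{c, d} \<noteq> {u, w}"
          using switch[of x z] z x_s from_x by metis
        then have "c = s" using from_x by simp
        then have "d = w'" using cd z h' common_nbr_unique[of s d z w'] r_sym by metis
        then show False using cd \<open>c = s\<close> h by simp
      qed
      have Nw: "z = s \<or> z = w2" if "r w' z" for z
        using bx[of z] bx[of w2] that w2' r_V2 b_unique r_irrefl by metis
      have "\<not> b y w'" using U_unmatched b_sym h' by blast
      moreover have "\<not> r y w'" 
      proof
        assume "r y w'"
        then have "y = w2" using Nw[of y] y r_sym by blast
        then show False using y w2' by simp
      qed
      moreover have "y \<noteq> w'" using y h' by auto
      \<comment> \<open>The path must reach \<open>w'\<close> through \<open>w2\<close>, since its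
        edge from \<open>s\<close> is switched. Then \<open>p\<close> and \<open>w'\<close> are both
        neighbours of \<open>w2\<close> in \<open>N1\<close>, so they coincide, although
        \<open>y\<close> is not adjacent to \<open>w'\<close>.\<close>
      ultimately obtain c d where cd: "r y c" "r c d" "r d w'" "{d, w'} \<noteq> {u, w}" "d \<noteq> y"
        using switch[of y w'] y h' r_V by metis
      have c: "c = p" using cd p in_N by blast
      have "d \<noteq> s" using cd h by (metis)
      then have d: "d = w2" using Nw cd r_sym by blast
      have "r w2 p" using cd c d r_sym by blast
      then have "p = w'" using N1_nbr_unique[of w2 p w'] w2' p h' r_sym by blast
      then show False using \<open>\<not> r y w'\<close> p in_N by blast
    qed
  qed
  show False
  proof (cases "u = s \<or> w = s")
    case True
    then show False using no_s[of w] no_s[of u] by (auto simp: insert_commute)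
  next
    case False
    then have su: "r s u" using u uw by (auto simp: N2_def)
    have "w \<noteq> x" using uw from_x False by blast
    then show False using no_N1[of u w] su False by simp
  qed
qed

text \<open>By \<open>degree_sum_leaf\<close> the degrees inside \<open>N2\<close> must sum to at
  least \<open>card N2 + card U - 3\<close>. Every vertex outside \<open>Z\<close> gives one and
  \<open>card Z \<le> 2\<close>, which settles the cases \<open>Z = {}\<close> and
  \<open>card U \<le> 1\<close>. Otherwise \<open>U\<close> is a clique inside
  \<open>N2 - Z\<close>, and its inner degrees supply the surplus; only
  \<open>card U = card Z = 2\<close> needs one unit more.\<close>

lemma leaf_bound: assumes "card U \<le> 3" shows "e V V + 7 \<ge> 3 * card V + card U"
proof -
  let ?d = "\<lambda>y. card (N y \<inter> N2)"
  have fin: "finite N2" "Z \<subseteq> N2" "finite Z" using V_split by (auto simp: Z_def)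
  have pos: "?d y \<ge> 1" if "y \<in> N2 - Z" for y
    using that by (auto simp: Z_def Suc_le_eq card_gt_0_iff)
  have split: "sum ?d N2 \<ge> sum ?d T + (card N2 - card Z - card T)"
    if T: "T \<subseteq> N2 - Z" for T
  proof -
    have "sum ?d N2 \<ge> sum ?d (N2 - Z)" by (rule sum_mono2) (use fin in auto)
    also have "sum ?d (N2 - Z) = sum ?d T + sum ?d (N2 - Z - T)"
      using T fin by (simp add: sum.subset_diff)
    finally have "sum ?d N2 \<ge> sum ?d T + sum ?d (N2 - Z - T)" by simp
    moreover have "sum ?d (N2 - Z - T) \<ge> (\<Sum>y\<in>N2 - Z - T. 1)" by (rule sum_mono) (use pos in auto)
    moreover have "card (N2 - Z - T) = card N2 - card Z - card T"
      using T fin by (simp add: card_Diff_subset finite_subset)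
    ultimately show ?thesis by simp
  qed
  have "sum ?d N2 + 3 \<ge> card N2 + card U"
  proof (cases "Z = {} \<or> card U \<le> 1")
    case True
    then show ?thesis using split[of "{}"] card_Z assms by auto
  next
    case False
    then obtain y where y: "y \<in> Z" by auto
    have finU: "finite U" using U_V finite_V finite_subset by blast
    have UN2: "U \<subseteq> N2"
    proof
      fix u assume u: "u \<in> U"
      have "\<exists>w. w \<in> U \<and> w \<noteq> u"
      proof (rule ccontr)
        assume "\<not> ?thesis"
        then have "U \<subseteq> {u}" by auto
        then have "card U \<le> 1" using card_mono[of "{u}" U] by simp
        then show False using False by simp
      qed
      then show "u \<in> N2" using U_N2[OF y u] by metis
    qed
    have dU: "?d u \<ge> card U - 1" if "u \<in> U" for u
    proof -
      have "U - {u} \<subseteq> N u \<inter> N2" using U_clique[OF that] UN2 by fastforce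
      then have "card (U - {u}) \<le> ?d u" by (intro card_mono) auto
      then show ?thesis using that finU by simp
    qed
    have UZ: "U \<subseteq> N2 - Z"
    proof
      fix u assume u: "u \<in> U"
      then have "N u \<inter> N2 \<noteq> {}" using dU[OF u] False assms by auto
      then show "u \<in> N2 - Z" using u UN2 unfolding Z_def by blast
    qed
    have cU: "card N2 - card Z \<ge> card U"
      using card_mono[OF _ UZ] fin by (simp add: card_Diff_subset)
    have sU: "sum ?d U \<ge> (card U - 1) * card U"
      using sum_mono[of U "\<lambda>_. card U - 1" ?d] dU by (simp add: mult.commute)
    note sp = split[OF UZ]
    show ?thesis
    proof (cases "card U = 3")
      case True
      then show ?thesis using sp cU sU card_Z by simp
    next
      case c3: False
      then have c2: "card U = 2" using assms False by simp
      then obtain u w where u: "U = {u, w}" "u \<noteq> w" by (auto simp: card_2_iff)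
      have "sum ?d U \<ge> 3" if "card Z = 2"
      proof -
        obtain y y' where yy: "Z = {y, y'}" "y \<noteq> y'" using \<open>card Z = 2\<close> by (auto simp: card_2_iff)
        then have yy': "y \<in> Z" "y' \<in> Z" by auto
        obtain p where p: "N y = {p}" "r s p" using Z_nbr[OF yy'(1)] .
        obtain p' where p': "N y' = {p'}" "r s p'" using Z_nbr[OF yy'(2)] .
        have pp: "r p p'" using Z_supports[OF yy' yy(2) p(1) p'(1)] .
        have uN: "u \<in> N2" "w \<in> N2" "r u w" using u UN2 U_clique by auto
        obtain t where t: "N u \<inter> N1 = {t}" by (rule card_1_singletonE[OF N2_parent[OF uN(1)]])
        have us: "\<not> r u s" using uN(1) r_comm by (auto simp: N2_def)
        \<comment> \<open>If \<open>w\<close> were the only neighbour of \<open>u\<close> in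
          \<open>N2\<close>, then after switching \<open>uw\<close> every red path from a leaf in
          \<open>Z\<close> to \<open>u\<close> would end with the edge \<open>t u\<close>. Both
          supports \<open>p\<close> and \<open>p'\<close> would then be adjacent to
          \<open>t\<close>, and also to each other, against the matching structure of
          \<open>N1\<close>.\<close>
        have "?d u \<noteq> 1"
        proof
          assume "?d u = 1"
          then obtain w' where w': "N u \<inter> N2 = {w'}" by (rule card_1_singletonE)
          have "w \<in> N u \<inter> N2" using uN by simp
          with w' have w'': "N u \<inter> N2 = {w}" by simp
          have Nu: "z = t \<or> z = w" if "r u z" for z
          proof -
            have "z \<in> N u" "z \<in> N1 \<or> z \<in> N2" using us that r_V2[OF that] by (auto simp: N2_def)
            then show ?thesis using t w'' by blast
          qed
          have adj: "r q t" if zZ: "z \<in> Z" and q: "N z = {q}" for z q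
          proof -
            have "\<not> r z u" using zZ uN by (auto simp: Z_def)
            moreover have "z \<noteq> u" using zZ UZ u by auto
            moreover have "\<not> b z u" using U_unmatched b_sym u by blast
            moreover have "z \<in> V" "u \<in> V" using zZ uN by (auto simp: Z_def N2_def)
            ultimately obtain c d where cd: "r z c" "r c d" "r d u" "{d, u} \<noteq> {u, w}"
              using U_switch[of u w z u] u(2) unfolding u(1) by blast
            have "c = q" using cd(1) q in_N[of c z] by simp
            moreover have "d = t" using Nu[OF r_sym[OF cd(3)]] cd(4) by (auto simp: insert_commute)
            ultimately show ?thesis using cd by simp
          qed
          have "r p t" "r p' t" using adj[OF yy'(1) p(1)] adj[OF yy'(2) p'(1)] by auto
          moreover have "r s t" using t by auto
          ultimately have "p' = t" using N1_nbr_unique[of p p' t] p(2) p'(2) pp by blast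
          then show False using \<open>r p' t\<close> r_irrefl by simp
        qed
        moreover have "?d u \<ge> 1" "?d w \<ge> 1" using dU[of u] dU[of w] c2 u by auto
        ultimately show ?thesis using u by simp
      qed
      moreover have "sum ?d U \<ge> 2" using sU c2 by simp
      ultimately show ?thesis using sp cU card_Z c2 by linarith
    qed
  qed
  then show ?thesis using degree_sum_leaf by linarith
qed

end

section \<open>A vertex of red degree two\<close>

locale red_deg2 = red_blue +
  fixes v a1 a2
  assumes N_v: "N v = {a1, a2}" and a12: "a1 \<noteq> a2"
    and min_deg: "\<And>x. x \<in> V \<Longrightarrow> card (N x) \<ge> 2"
begin

definition "L2 = (N a1 \<union> N a2) - {v, a1, a2}"
text \<open>By \<open>L3_d2\<close>, that is by saturation at \<open>v\<close>, these are the
  vertices at distance exactly three from \<open>v\<close>.\<close>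

definition "L3 = V - {v, a1, a2} - L2"

lemma v_nbr: "r v x \<longleftrightarrow> x = a1 \<or> x = a2"
  using N_v in_N[of x v] by simp

lemma v_facts: "r a1 v" "r a2 v" "v \<noteq> a1" "v \<noteq> a2" "v \<in> V" "a1 \<in> V" "a2 \<in> V"
proof -
  have "r v a1" "r v a2" by (simp_all add: v_nbr)
  then show "r a1 v" "r a2 v" "v \<noteq> a1" "v \<noteq> a2" "v \<in> V" "a1 \<in> V" "a2 \<in> V"
    using r_sym r_irrefl r_V r_V2 by auto
qed

lemma V_split: "V = {v} \<union> ({a1, a2} \<union> (L2 \<union> L3))" "{v} \<inter> ({a1, a2} \<union> (L2 \<union> L3)) = {}"
  "{a1, a2} \<inter> (L2 \<union> L3) = {}" "L2 \<inter> L3 = {}" "finite L2" "finite L3"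
  using v_facts N_subset finite_V unfolding L2_def L3_def by auto

lemma L2_V: "y \<in> L2 \<Longrightarrow> y \<in> V" and L3_V: "z \<in> L3 \<Longrightarrow> z \<in> V" using V_split(1) by blast+

text \<open>The vertex \<open>v\<close> is already a common neighbour of \<open>a1\<close> and
  \<open>a2\<close>, so there is no second one.\<close>

lemma L2_a: assumes "y \<in> L2" shows "card (N y \<inter> {a1, a2}) = 1"
proof -
  have y: "r a1 y \<or> r a2 y" "y \<noteq> v" using assms unfolding L2_def by auto
  have "\<not> (r a1 y \<and> r a2 y)" using common_nbr_unique[of a1 v a2 y] v_facts a12 y(2) by blast
  then have "N y \<inter> {a1, a2} = {a1} \<or> N y \<inter> {a1, a2} = {a2}"
    using y(1) r_comm[of a1 y] r_comm[of a2 y] by auto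
  then show ?thesis by auto
qed

lemma L2_v: "y \<in> L2 \<Longrightarrow> \<not> r y v" "y \<in> L2 \<Longrightarrow> \<not> r v y"
  using v_nbr[of y] r_comm[of y v] unfolding L2_def by auto

lemma L3_a: "z \<in> L3 \<Longrightarrow> N z \<inter> {v, a1, a2} = {}"
  using v_nbr[of z] r_comm[of z v] r_comm[of z a1] r_comm[of z a2] unfolding L2_def L3_def by auto

lemma L3_v: "z \<in> L3 \<Longrightarrow> \<not> r v z" using v_nbr[of z] unfolding L3_def by auto

lemma L3_parent:
  assumes "z \<in> L3" "r v s" "r s t" "r t z" "t \<noteq> v" shows "t \<in> L2"
proof -
  have "t \<notin> {a1, a2}" using L3_a[OF assms(1)] assms(4) r_comm[of t z] by auto
  then show ?thesis using assms(2,3,5) v_nbr[of s] unfolding L2_def by auto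
qed

lemma L3_d2: assumes "z \<in> L3" shows "N z \<inter> L2 \<noteq> {}"
proof -
  obtain s t where st: "r v s" "r s t" "r t z" "t \<noteq> v"
    using saturated[of v z] v_facts(5) L3_V[OF assms] L3_v[OF assms] assms unfolding L3_def by blast
  then have "t \<in> L2" using L3_parent[OF assms] by blast
  then show ?thesis using r_sym[OF st(3)] by auto
qed

section \<open>Contributions of the distance levels to the degree sum\<close>

abbreviation "d2 x \<equiv> card (N x \<inter> L2)"
abbreviation "d3 x \<equiv> card (N x \<inter> L3)"

lemma d2_pos: "N x \<inter> L2 \<noteq> {} \<Longrightarrow> d2 x \<ge> 1"
  using card_gt_0_iff[of "N x \<inter> L2"] by auto

lemma L3_degree: assumes "z \<in> L3" shows "card (N z) = d2 z + d3 z"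
proof -
  have "N z = N z \<inter> (L2 \<union> L3)"
    using N_subset[of z] L3_a[OF assms] V_split(1) by blast
  then have "card (N z) = card (N z \<inter> (L2 \<union> L3))" by (rule arg_cong)
  then show ?thesis using card_N_Un[OF V_split(4)] by simp
qed

text \<open>The weight \<open>2 * d2 z + d3 z\<close> is the share of \<open>z\<close> when both
  ends of each edge between \<open>L2\<close> and \<open>L3\<close> are charged to
  \<open>L3\<close>. It is the degree, at least two, plus \<open>d2 z\<close>, at least one.\<close>

lemma L3_pos: assumes "z \<in> L3" shows "2 * d2 z + d3 z \<ge> 3"
  using L3_degree[OF assms] min_deg[OF L3_V[OF assms]] d2_pos[OF L3_d2[OF assms]] by linarith

lemma card_V_split: "card V = 3 + card L2 + card L3"
proof -
  have "card V = card ({v} \<union> ({a1, a2} \<union> (L2 \<union> L3)))" using V_split(1) by (rule arg_cong)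
  also have "\<dots> = card {v} + card ({a1, a2} \<union> (L2 \<union> L3))"
    by (rule card_Un_disjoint) (use V_split(2,5,6) in auto)
  also have "card ({a1, a2} \<union> (L2 \<union> L3)) = card {a1, a2} + card (L2 \<union> L3)"
    by (rule card_Un_disjoint) (use V_split(3,5,6) in auto)
  also have "card (L2 \<union> L3) = card L2 + card L3"
    by (rule card_Un_disjoint) (use V_split(4,5,6) in auto)
  finally show ?thesis using a12 by simp
qed

text \<open>As \<open>card V = 3 + card L2 + card L3\<close>, contributions
  \<open>d2 \<ge> 1\<close> on \<open>L2\<close> and weights at least 3 on \<open>L3\<close> would
  give \<open>3 * card V - 5\<close>, and the edge between \<open>a1\<close> and \<open>a2\<close>,
  if red, adds two more.\<close>

lemma degree_sum_deg2:
  "e V V = 4 + (if r a1 a2 then 2 else 0) + 2 * card L2 + sum d2 L2 + (\<Sum>z\<in>L3. 2 * d2 z + d3 z)"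
proof -
  let ?A = "{a1, a2}"
  have "e V V = e ({v} \<union> (?A \<union> (L2 \<union> L3))) ({v} \<union> (?A \<union> (L2 \<union> L3)))"
    using V_split(1) by (rule arg_cong)
  also have "\<dots> = e {v} {v} + 2 * e {v} (?A \<union> (L2 \<union> L3)) + e (?A \<union> (L2 \<union> L3)) (?A \<union> (L2 \<union> L3))"
    by (rule e_Un_both) (use V_split(2,5,6) in auto)
  also have "e (?A \<union> (L2 \<union> L3)) (?A \<union> (L2 \<union> L3))
      = e ?A ?A + 2 * e ?A (L2 \<union> L3) + e (L2 \<union> L3) (L2 \<union> L3)"
    by (rule e_Un_both) (use V_split(3,5,6) in auto)
  also have "e (L2 \<union> L3) (L2 \<union> L3) = e L2 L2 + 2 * e L3 L2 + e L3 L3"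
    using e_Un_both[OF V_split(5,6,4)] e_sym[OF V_split(5,6)] by simp
  also have "e {v} {v} = 0" using N_v v_facts by (simp add: e_def)
  also have "e {v} (?A \<union> (L2 \<union> L3)) = 2" using N_v a12 by (simp add: e_def)
  also have "e ?A ?A = (if r a1 a2 then 2 else 0)"
  proof -
    have "N a1 \<inter> ?A = (if r a1 a2 then {a2} else {})" "N a2 \<inter> ?A = (if r a1 a2 then {a1} else {})"
      using r_irrefl r_comm[of a1 a2] by auto
    then show ?thesis using a12 by (simp add: e_def)
  qed
  also have "e ?A (L2 \<union> L3) = card L2"
  proof -
    have "e ?A (L2 \<union> L3) = e L2 ?A + e L3 ?A"
      using e_Un_right[OF V_split(4)] e_sym[of ?A] V_split(5,6) by simp
    moreover have "e L2 ?A = card L2" using e_card[of L2 ?A 1] L2_a by simp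
    moreover have "e L3 ?A = 0"
    proof -
      have "N z \<inter> ?A = {}" if "z \<in> L3" for z using L3_a[OF that] by blast
      then show ?thesis by (simp add: e_def)
    qed
    ultimately show ?thesis by simp
  qed
  finally show ?thesis by (simp add: e_def sum.distrib sum_distrib_left)
qed

text \<open>Since \<open>a1\<close> and \<open>a2\<close> are not adjacent, the third vertex of a
  red path from \<open>v\<close> lies in \<open>L2\<close>, whence \<open>d2 \<ge> 1\<close> on
  \<open>L2\<close>. This suffices for \<open>card U \<le> 2\<close>; for \<open>card U = 3\<close>
  it remains to exclude that all contributions are minimal.\<close>

lemma bound_nonadjacent:
  assumes a: "\<not> r a1 a2" and U3: "card U \<le> 3"
  shows "e V V + 7 \<ge> 3 * card V + card U"
proof -
  have path_L2: "t \<in> L2" if "r v s" "r s t" "t \<noteq> v" for s t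
    using that v_nbr[of s] a r_comm[of a1 a2] r_irrefl unfolding L2_def by auto
  have L2_pos: "d2 y \<ge> 1" if y: "y \<in> L2" for y
  proof -
    obtain s t where st: "r v s" "r s t" "r t y" "t \<noteq> v"
      using saturated[of v y] v_facts(5) L2_V[OF y] L2_v[OF y] y unfolding L2_def by blast
    have "t \<in> N y \<inter> L2" using path_L2[OF st(1,2,4)] r_sym[OF st(3)] by simp
    then show ?thesis using d2_pos by blast
  qed
  have s2: "sum d2 L2 \<ge> card L2" using sum_mono[of L2 "\<lambda>_. 1" d2] L2_pos by simp
  have s3: "(\<Sum>z\<in>L3. 2 * d2 z + d3 z) \<ge> 3 * card L3"
    using sum_mono[of L3 "\<lambda>_. 3" "\<lambda>z. 2 * d2 z + d3 z"] L3_pos by simp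
  have "sum d2 L2 + (\<Sum>z\<in>L3. 2 * d2 z + d3 z) > card L2 + 3 * card L3" if c3: "card U = 3"
  proof (cases "(\<exists>y\<in>L2. d2 y > 1) \<or> (\<exists>z\<in>L3. 2 * d2 z + d3 z > 3)")
    case True
    then have "sum d2 L2 > card L2 \<or> (\<Sum>z\<in>L3. 2 * d2 z + d3 z) > 3 * card L3"
      using sum_strict_mono_ex1[OF V_split(5), of "\<lambda>_. 1" d2] L2_pos
        sum_strict_mono_ex1[OF V_split(6), of "\<lambda>_. 3" "\<lambda>z. 2 * d2 z + d3 z"] L3_pos
      by (auto simp: mult.commute)
    then show ?thesis using s2 s3 by linarith
  next
    case False
    \<comment> \<open>With all contributions minimal, each vertex of \<open>L2\<close> or
      \<open>L3\<close> has a unique neighbour in \<open>L2\<close>, and each vertex of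
      \<open>L3\<close> a unique neighbour in \<open>L3\<close>.\<close>
    have d2_1: "d2 y = 1" if "y \<in> L2 \<union> L3" for y
    proof (cases "y \<in> L2")
      case True
      then show ?thesis using L2_pos[of y] False by force
    next
      case h: False
      then have y: "y \<in> L3" using that by simp
      then have "2 * d2 y + d3 y = 3" using L3_pos[OF y] False by force
      then show ?thesis using d2_pos[OF L3_d2[OF y]] by linarith
    qed
    have d3_1: "d3 y = 1" if "y \<in> L3" for y
      using d2_1[of y] that L3_pos[OF that] False by force
    \<comment> \<open>otherwise switching \<open>ww'\<close> leaves no red path with three edges between \<open>v\<close> and \<open>w\<close>\<close>
    have parent: "w' \<notin> U" if w: "w \<in> U" "w \<in> L2 \<union> L3" "r w w'" "w' \<in> L2" for w w'
    proof
      assume w': "w' \<in> U"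
      have wv: "\<not> r v w" "\<not> b v w" "w \<noteq> v" "w \<in> V" "w' \<noteq> w"
        using w(2) L2_v L3_v U_unmatched[OF w(1)] b_sym L2_V L3_V w(3) r_irrefl
        unfolding L2_def L3_def by blast+
      obtain s t where st: "r v s" "r s t" "r t w" "t \<noteq> v" "{t, w} \<noteq> {w', w}"
        using U_switch[OF w' w(1) wv(5) v_facts(5) wv(4)] wv by blast
      obtain q where q: "N w \<inter> L2 = {q}" by (rule card_1_singletonE[OF d2_1[OF w(2)]])
      have "t \<in> N w \<inter> L2" using path_L2[OF st(1,2,4)] r_sym[OF st(3)] by simp
      moreover have "w' \<in> N w \<inter> L2" using w by simp
      ultimately have "t = w'" unfolding q by simp
      then show False using st(5) by simp
    qed
    obtain u1 u2 u3 where u: "U = {u1, u2, u3}" "u1 \<noteq> u2" "u1 \<noteq> u3" "u2 \<noteq> u3"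
      using c3 by (auto simp: card_3_iff)
    have adj: "r p q" if "p \<in> U" "q \<in> U" "p \<noteq> q" for p q using U_clique that by blast
    have no3: "w \<notin> L3" if w: "w \<in> U" for w
    proof
      assume w3: "w \<in> L3"
      have "U - {w} \<subseteq> N w \<inter> L3"
      proof
        fix q assume q: "q \<in> U - {w}"
        then have rq: "r w q" using adj w by blast
        then have "q \<notin> L2" using parent[of w q] w w3 q by blast
        moreover have "q \<notin> {v, a1, a2}" using L3_a[OF w3] rq by auto
        ultimately show "q \<in> N w \<inter> L3" using rq r_V2[OF rq] by (simp add: L3_def)
      qed
      then have "card (U - {w}) \<le> d3 w" by (intro card_mono) auto
      then show False using d3_1[OF w3] w c3 by (simp add: card_Diff_singleton)
    qed
    have uV: "p \<in> {v, a1, a2} \<or> p \<in> L2" if "p \<in> U" for p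
      using no3[OF that] U_V that V_split(1) by blast
    have one2: "p \<notin> L2 \<or> q \<notin> L2" if "p \<in> U" "q \<in> U" "p \<noteq> q" for p q
      using parent[of p q] adj[OF that] that by blast
    have aa: "\<not> (p \<in> {a1, a2} \<and> q \<in> {a1, a2})" if "p \<in> U" "q \<in> U" "p \<noteq> q" for p q
      using adj[OF that] a r_comm[of a1 a2] that(3) by auto
    have vv: "\<not> (p = v \<and> q \<in> L2)" if "p \<in> U" "q \<in> U" "p \<noteq> q" for p q
      using adj[OF that] L2_v by blast
    \<comment> \<open>The triangle \<open>U\<close> avoids \<open>L3\<close> and has at most one
      vertex in each of \<open>L2\<close> and \<open>{a1, a2}\<close>, so it would contain
      \<open>v\<close> and a vertex of \<open>L2\<close>; these are not adjacent.\<close>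
    have False
      using uV[of u1] uV[of u2] uV[of u3] one2[of u1 u2] one2[of u1 u3] one2[of u2 u3]
        aa[of u1 u2] aa[of u1 u3] aa[of u2 u3] vv[of u1 u2] vv[of u1 u3] vv[of u2 u3]
        vv[of u2 u1] vv[of u3 u1] vv[of u3 u2] u by auto
    then show ?thesis ..
  qed
  then show ?thesis using degree_sum_deg2 card_V_split a U3 s2 s3 by (cases "card U = 3") auto
qed

text \<open>
  A vertex \<open>y\<close> of \<open>L2\<close> without neighbours in \<open>L2\<close> lacks one unit, which is paid by a neighbour in \<open>L3\<close>
  of degree at least three. If \<open>y\<close> has no such neighbour, then \<open>y\<close> is the apex of a triangle whose other
  two vertices have degree two, and there is at most one such \<open>y\<close> since no red path with three edges
  joins the bases of two such triangles.
\<close>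
lemma bound_triangle:
  assumes tri: "\<And>x p q. x \<in> V \<Longrightarrow> N x = {p, q} \<Longrightarrow> p \<noteq> q \<Longrightarrow> r p q"
  shows "e V V + 4 \<ge> 3 * card V"
proof -
  define Y where "Y = {y \<in> L2. N y \<inter> L2 = {}}"
  define T where "T = {z \<in> L3. card (N z) \<ge> 3}"
  define D where "D = {y \<in> Y. N y \<inter> T = {}}"
  have fin: "finite Y" "finite T" "finite D" "Y \<subseteq> L2" "T \<subseteq> L3" "D \<subseteq> Y"
    using V_split(5,6) unfolding Y_def T_def D_def by auto
  have deg2: "\<exists>w. N z = {y, w} \<and> w \<noteq> y \<and> r y w" if z: "z \<in> L3 - T" "r z y" for z y
  proof -
    have zV: "z \<in> V" using z L3_V by blast
    then have "card (N z) = 2" using min_deg[of z] z by (auto simp: T_def)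
    then obtain p q where pq: "N z = {p, q}" "p \<noteq> q" by (auto simp: card_2_iff)
    have rpq: "r p q" using tri[OF zV pq] .
    have "y \<in> {p, q}" using z(2) in_N[of y z] pq by simp
    then show ?thesis using pq rpq r_sym[OF rpq] by (auto simp: insert_commute)
  qed
  have ends: "\<exists>z w. z \<in> L3 \<and> w \<in> L3 \<and> N z = {y, w} \<and> N w = {y, z}" if y: "y \<in> D" for y
  proof -
    have yL: "y \<in> L2" "N y \<inter> L2 = {}" "N y \<inter> T = {}" using y unfolding D_def Y_def by auto
    have L3: "q \<in> L3 - T" if q: "r y q" "q \<notin> {a1, a2}" for q
    proof -
      have "q \<noteq> v" using L2_v(1)[OF yL(1)] q by blast
      moreover have "q \<notin> L2" "q \<notin> T" using yL q(1) by auto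
      ultimately show ?thesis using q r_V2[OF q(1)] by (simp add: L3_def)
    qed
    \<comment> \<open>Of its at least two neighbours, \<open>y\<close> has only one among
      \<open>a1\<close>, \<open>a2\<close>. Another lies in \<open>L3 - T\<close>, thus has degree
      two, and \<open>tri\<close> completes the triangle.\<close>
    have "\<not> N y \<subseteq> {a1, a2}"
    proof
      assume "N y \<subseteq> {a1, a2}"
      then have "N y \<inter> {a1, a2} = N y" by blast
      then show False using L2_a[OF yL(1)] min_deg[OF L2_V[OF yL(1)]] by simp
    qed
    then obtain z where "z \<in> N y" "z \<notin> {a1, a2}" by blast
    then have "r y z" "z \<notin> {a1, a2}" by auto
    then have z: "z \<in> L3 - T" "r z y" using L3 r_sym by blast+
    then obtain w where w: "N z = {y, w}" "w \<noteq> y" "r y w" using deg2[OF z] by blast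
    have "w \<notin> {a1, a2}" using L3_a[of z] z(1) w(1) by auto
    then have w3: "w \<in> L3 - T" using L3[OF w(3)] by blast
    then obtain w' where w': "N w = {y, w'}" using deg2[OF w3 r_sym[OF w(3)]] by blast
    have "r z w" using w(1) in_N[of w z] by simp
    then have "z \<in> N w" by (simp add: r_comm)
    moreover have "z \<noteq> y" using z r_irrefl by blast
    ultimately have "N w = {y, z}" using w' by blast
    then show ?thesis using z w3 w(1) by blast
  qed
  have D1: "card D \<le> 1"
  proof (rule ccontr)
    assume "\<not> ?thesis"
    then obtain T' where "T' \<subseteq> D" "card T' = 2" using obtain_subset_with_card_n[of 2 D] by auto
    then obtain y y' where y: "y \<in> D" "y' \<in> D" "y \<noteq> y'" by (auto simp: card_2_iff)
    obtain z w where z: "z \<in> L3" "w \<in> L3" "N z = {y, w}" "N w = {y, z}" using ends[OF y(1)] by blast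
    obtain z' w' where z': "z' \<in> L3" "w' \<in> L3" "N z' = {y', w'}" "N w' = {y', z'}"
      using ends[OF y(2)] by blast
    have yL: "y \<in> L2" "y' \<in> L2" "N y \<inter> L2 = {}" using y unfolding D_def Y_def by auto
    have ne: "q \<noteq> y" "q \<noteq> y'" if "q \<in> L3" for q using yL that V_split(4) by blast+
    have rz: "r z q \<longleftrightarrow> q = y \<or> q = w" "r w q \<longleftrightarrow> q = y \<or> q = z"
      "r z' q \<longleftrightarrow> q = y' \<or> q = w'" "r w' q \<longleftrightarrow> q = y' \<or> q = z'" for q
      using in_N[of q z] in_N[of q w] in_N[of q z'] in_N[of q w'] z z' by auto
    have "y' \<notin> N z" using z ne[OF z(2)] y(3) by auto
    then have zz': "z \<noteq> z'" using z'(3) by auto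
    have wz': "w \<noteq> z'"
    proof
      assume "w = z'"
      then have "y' \<in> N w" using z'(3) by simp
      then show False using z(4) ne[OF z(1)] y(3) by auto
    qed
    have "\<not> r z z'" using rz(1) wz' ne[OF z'(1)] by simp
    then obtain s t where st: "r z s" "r s t" "r t z'" "t \<noteq> z"
      using saturated[OF L3_V[OF z(1)] L3_V[OF z'(1)] zz'] by blast
    have t: "t = y' \<or> t = w'" using rz(3)[of t] r_sym[OF st(3)] by simp
    \<comment> \<open>From \<open>z\<close> the path goes to \<open>y\<close> or to
      \<open>w\<close>, and in the latter case on to \<open>y\<close>; it must reach
      \<open>z'\<close> from \<open>y'\<close> or \<open>w'\<close>. The triangles have no common
      vertex and \<open>y\<close> is adjacent to neither \<open>y'\<close> nor \<open>w'\<close>, so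
      it is too short.\<close>
    show False
    proof (cases "s = y")
      case True
      then have "t \<notin> L2" using st(2) yL(3) by auto
      then have "t = w'" using t yL by blast
      then have "y \<in> {y', z'}" using rz(4)[of y] r_sym[OF st(2)] True by simp
      then show False using y(3) ne[OF z'(1)] by auto
    next
      case False
      then have "s = w" using rz(1) st(1) by blast
      then have "t = y" using rz(2) st(2,4) by blast
      then show False using t y(3) ne[OF z'(2)] by auto
    qed
  qed
  have s2: "sum d2 L2 + card Y \<ge> card L2"
  proof -
    have "(\<Sum>y\<in>L2 - Y. 1) \<le> sum d2 (L2 - Y)"
      by (rule sum_mono, rule d2_pos) (auto simp: Y_def)
    also have "\<dots> \<le> sum d2 L2" by (rule sum_mono2) (use V_split(5) in auto)
    finally show ?thesis using fin V_split(5) by (simp add: card_Diff_subset)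
  qed
  have s3: "(\<Sum>z\<in>L3. 2 * d2 z + d3 z) \<ge> 3 * card L3 + e T L2"
  proof -
    \<comment> \<open>For \<open>z\<close> in \<open>T\<close> the degree \<open>d2 z + d3 z\<close>
      is at least 3, so the weight exceeds 3 by at least \<open>d2 z\<close>, one unit for each edge
      from \<open>z\<close> to \<open>L2\<close>.\<close>
    have "(\<Sum>z\<in>L3. 3 + (if z \<in> T then d2 z else 0)) \<le> (\<Sum>z\<in>L3. 2 * d2 z + d3 z)"
    proof (rule sum_mono)
      fix z assume z: "z \<in> L3"
      show "3 + (if z \<in> T then d2 z else 0) \<le> 2 * d2 z + d3 z"
        using L3_pos[OF z] L3_degree[OF z] by (auto simp: T_def)
    qed
    moreover have "(\<Sum>z\<in>L3. if z \<in> T then d2 z else 0) = e T L2"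
      unfolding e_def using V_split(6) fin(5)
      by (simp add: sum.inter_restrict[symmetric] Int_absorb1)
    ultimately show ?thesis by (simp add: sum.distrib mult.commute)
  qed
  \<comment> \<open>Each vertex of \<open>Y - D\<close> is paid by one of its own edges to
    \<open>T\<close>.\<close>
  have sT: "e T L2 \<ge> card (Y - D)"
  proof -
    have "(\<Sum>y\<in>Y - D. 1) \<le> (\<Sum>y\<in>Y - D. card (N y \<inter> T))"
      by (rule sum_mono) (auto simp: D_def Suc_le_eq card_gt_0_iff)
    also have "\<dots> \<le> e L2 T" unfolding e_def
      by (rule sum_mono2) (use V_split(5) fin(4) in auto)
    also have "\<dots> = e T L2" by (rule e_sym[OF V_split(5) fin(2)])
    finally show ?thesis by simp
  qed
  have "card (Y - D) + 1 \<ge> card Y" using D1 fin by (simp add: card_Diff_subset)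
  moreover have "r a1 a2" using tri[OF v_facts(5) N_v a12] .
  ultimately show ?thesis using degree_sum_deg2 card_V_split s2 s3 sT by simp
qed

end

text \<open>Four cases: a red leaf; a vertex of degree two with non-adjacent neighbours; all
  vertices of degree two lying in triangles, where the loss of 4 is good enough for
  \<open>card U \<le> 3\<close>; minimum degree three.\<close>

lemma (in red_blue) degree_sum_bound:
  assumes "card U \<le> 3" shows "(\<Sum>x\<in>V. card (N x)) + 7 \<ge> 3 * card V + card U"
proof (cases "\<exists>x\<in>V. card (N x) \<le> 1")
  case True
  then obtain x where x: "x \<in> V" "card (N x) \<le> 1" by blast
  then have "card (N x) = 1" using N_nonempty[OF x(1)] card_gt_0_iff[of "N x"] by (simp add: le_less)
  then obtain s where "N x = {s}" by (rule card_1_singletonE)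
  then interpret red_leaf V r b U x s by unfold_locales
  show ?thesis using leaf_bound[OF assms] degree_sum by simp
next
  case False
  then have deg: "card (N x) \<ge> 2" if "x \<in> V" for x using that by force
  show ?thesis
  proof (cases "\<exists>v a1 a2. v \<in> V \<and> N v = {a1, a2} \<and> a1 \<noteq> a2 \<and> \<not> r a1 a2")
    case True
    then obtain v a1 a2 where v: "N v = {a1, a2}" "a1 \<noteq> a2" "\<not> r a1 a2" by blast
    then interpret red_deg2 V r b U v a1 a2 by unfold_locales (use deg in auto)
    show ?thesis using bound_nonadjacent[OF v(3) assms] degree_sum by simp
  next
    case tri: False
    show ?thesis
    proof (cases "\<exists>v\<in>V. card (N v) = 2")
      case True
      then obtain v a1 a2 where v: "N v = {a1, a2}" "a1 \<noteq> a2" by (auto simp: card_2_iff)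
      then interpret red_deg2 V r b U v a1 a2 by unfold_locales (use deg in auto)
      show ?thesis using bound_triangle tri degree_sum assms by force
    next
      case False
      then have "card (N x) \<ge> 3" if "x \<in> V" for x using deg[OF that] that by force
      then have "(\<Sum>x\<in>V. card (N x)) \<ge> (\<Sum>x\<in>V. 3)" by (rule sum_mono)
      then show ?thesis using assms by simp
    qed
  qed
qed

section \<open>The lower bound\<close>

text \<open>Making \<open>pq\<close> red creates no blue edge, so it must create a red C4 through
  \<open>pq\<close>; removing \<open>pq\<close> from it leaves the path. This covers both adding a
  non-edge and recolouring a blue edge.\<close>

lemma red_path_of_not_critical:
  assumes E: "E \<subseteq> all_pairs V" and crit: "critical_colouring C4 K12 (V, E) col"
    and pq: "p \<in> V" "q \<in> V" "p \<noteq> q" and nr: "\<not> ({p, q} \<in> E \<and> col {p, q} = Red)"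
    and ncrit: "\<not> critical_colouring C4 K12 (V, insert {p, q} E) (col({p, q} := Red))"
  defines "r \<equiv> \<lambda>x y. {x, y} \<in> E \<and> col {x, y} = Red"
  shows "\<exists>s t. r p s \<and> r s t \<and> r t q \<and> s \<noteq> q \<and> t \<noteq> p"
proof -
  have E': "insert {p, q} E \<subseteq> all_pairs V" using E pq by (simp add: pair_in_all_pairs)
  define r' where "r' x y \<longleftrightarrow> r x y \<or> {x, y} = {p, q}" for x y
  have r_sym: "r x y \<longleftrightarrow> r y x" for x y by (simp add: r_def insert_commute)
  have r_irrefl: "\<not> r x x" for x
    using E pair_in_all_pairs[of x x V] by (auto simp: r_def)
  have irrefl: "\<not> r' x x" for x using r_irrefl[of x] pq(3) by (auto simp: r'_def)
  note C = crit[unfolded critical_colouring_C4_K12_iff[OF E]]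
  have free: "a = c \<or> b = d" if "r a b" "r b c" "r c d" "r d a" for a b c d
    using C[THEN conjunct1, rule_format, of a b c d] that by (simp add: r_def)
  have "\<exists>a b c d. r' a b \<and> r' b c \<and> r' c d \<and> r' d a \<and> a \<noteq> c \<and> b \<noteq> d"
  proof (rule ccontr)
    assume no: "\<not> ?thesis"
    have red: "({x, y} \<in> insert {p, q} E \<and> (col({p, q} := Red)) {x, y} = Red) \<longleftrightarrow> r' x y" for x y
      by (auto simp: r_def r'_def)
    have blue: "{x, y} \<in> E \<and> col {x, y} = Blue"
      if "{x, y} \<in> insert {p, q} E \<and> (col({p, q} := Red)) {x, y} = Blue" for x y
      using that by (auto split: if_splits)
    have "critical_colouring C4 K12 (V, insert {p, q} E) (col({p, q} := Red))"
      unfolding critical_colouring_C4_K12_iff[OF E'] red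
    proof (intro conjI allI impI)
      fix a b c d assume "r' a b" "r' b c" "r' c d" "r' d a"
      then show "a = c \<or> b = d" using no by fast
    next
      fix x y z
      assume "{x, y} \<in> insert {p, q} E \<and> (col({p, q} := Red)) {x, y} = Blue"
        "{x, z} \<in> insert {p, q} E \<and> (col({p, q} := Red)) {x, z} = Blue"
      from blue[OF this(1)] blue[OF this(2)] show "y = z"
        by (rule C[THEN conjunct2, rule_format])
    qed
    then show False using ncrit by simp
  qed
  then obtain a b c d where abcd: "r' a b" "r' b c" "r' c d" "r' d a" "a \<noteq> c" "b \<noteq> d" by blast
  have main: "\<exists>s t. r p s \<and> r s t \<and> r t q \<and> s \<noteq> q \<and> t \<noteq> p"
    if h: "{a, b} = {p, q}" "r' b c" "r' c d" "r' d a" "a \<noteq> c" "b \<noteq> d" for a b c d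
  proof -
    have ne: "b \<noteq> c" "c \<noteq> d" "d \<noteq> a"
      using h(2-4) irrefl by metis+
    \<comment> \<open>The cycle traverses \<open>pq\<close> only once, so its other three edges were
      red before. The four cases below rotate the cycle to put \<open>pq\<close> first.\<close>
    have "{b, c} \<noteq> {a, b}" "{c, d} \<noteq> {a, b}" "{d, a} \<noteq> {a, b}"
      using ne h(5,6) by (simp_all add: doubleton_eq_iff)
    then have path: "r b c" "r c d" "r d a" using h(1-4) by (simp_all add: r'_def)
    consider "a = p" "b = q" | "a = q" "b = p" using h(1) by (auto simp: doubleton_eq_iff)
    then show ?thesis
    proof cases
      case 1
      then show ?thesis
        using path h(5,6) r_sym[of a d] r_sym[of c d] r_sym[of b c]
        by (intro exI[of _ d] exI[of _ c]) simp
    next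
      case 2
      then show ?thesis using path h(5,6) by (intro exI[of _ c] exI[of _ d]) simp
    qed
  qed
  consider "{a, b} = {p, q}" | "{b, c} = {p, q}" | "{c, d} = {p, q}" | "{d, a} = {p, q}"
    using free[of a b c d] abcd unfolding r'_def by argo
  then show ?thesis
  proof cases
    case 1
    show ?thesis by (rule main[OF 1 abcd(2-6)])
  next
    case 2
    show ?thesis by (rule main[OF 2 abcd(3,4,1,6) abcd(5)[symmetric]])
  next
    case 3
    show ?thesis by (rule main[OF 3 abcd(4,1,2) abcd(5)[symmetric] abcd(6)[symmetric]])
  next
    case 4
    show ?thesis by (rule main[OF 4 abcd(1-3) abcd(6)[symmetric] abcd(5)])
  qed
qed

theorem co_critical_C4_K12_lower_bound:
  fixes G :: "'a graph"
  assumes co: "co_critical C4 K12 G" and n: "card (verts G) \<ge> 3"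
  shows "2 * card (verts G) \<le> card (edges G) + 3"
proof -
  obtain V E where G: "G = (V, E)" by (cases G)
  have fin: "finite V" and E: "E \<subseteq> all_pairs V"
    and ex: "\<exists>c. critical_colouring C4 K12 (V, E) c"
    using co by (simp_all add: G co_critical_def simple_graph_def verts_def edges_def)
  have ext: "\<not> critical_colouring C4 K12 (V, insert {p, q} E) c"
    if "p \<in> V" "q \<in> V" "p \<noteq> q" "{p, q} \<notin> E" for p q c
  proof -
    have "{p, q} \<in> edges (complement_graph G)"
      using that by (simp add: G complement_graph_def verts_def edges_def pair_in_all_pairs)
    then have "\<not> (\<exists>c. critical_colouring C4 K12 (add_edge G {p, q}) c)"
      using co unfolding co_critical_def by blast
    then show ?thesis by (simp add: G add_edge_def verts_def edges_def)
  qed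
  have finE: "finite E"
    by (rule finite_subset[OF E], rule finite_subset[of _ "Pow V"])
      (use fin in \<open>auto simp: all_pairs_def\<close>)
  let ?blue = "\<lambda>c. card {e \<in> E. c e = Blue}"
  obtain c0 where "critical_colouring C4 K12 (V, E) c0" using ex by blast
  from ex_has_least_nat[of "critical_colouring C4 K12 (V, E)", OF this, of ?blue]
  obtain col where crit: "critical_colouring C4 K12 (V, E) col"
    and least: "\<And>c. critical_colouring C4 K12 (V, E) c \<Longrightarrow> ?blue col \<le> ?blue c"
    by blast
  define r where "r x y \<longleftrightarrow> {x, y} \<in> E \<and> col {x, y} = Red" for x y
  define b where "b x y \<longleftrightarrow> {x, y} \<in> E \<and> col {x, y} = Blue" for x y
  define U where "U = {x \<in> V. \<forall>y. \<not> b x y}"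
  note C = crit[unfolded critical_colouring_C4_K12_iff[OF E]]
  have C4: "p = s \<or> q = t" if "r p q" "r q s" "r s t" "r t p" for p q s t
    using C[THEN conjunct1, rule_format, of p q s t] that by (simp add: r_def)
  have b_unique: "y = z" if "b x y" "b x z" for x y z
    using C[THEN conjunct2, rule_format, of x y z] that by (simp add: b_def)
  have pair: "x \<noteq> y \<and> x \<in> V \<and> y \<in> V" if "{x, y} \<in> E" for x y
    using subsetD[OF E that] by (simp add: pair_in_all_pairs)
  have rb: "{x, y} \<in> E \<longleftrightarrow> r x y \<or> b x y" "\<not> (r x y \<and> b x y)" for x y
    unfolding r_def b_def by (cases "col {x, y}"; auto)+
  \<comment> \<open>No blue edge meets \<open>u\<close> or \<open>w\<close>, so a non-edge
    \<open>uw\<close> could be added in blue.\<close>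
  have clique: "r u w" if u: "u \<in> U" "w \<in> U" "u \<noteq> w" for u w
  proof (rule ccontr)
    assume nr: "\<not> r u w"
    have uV: "u \<in> V" "w \<in> V" and nb: "\<not> b u y" "\<not> b w y" "\<not> b y u" "\<not> b y w" for y
      using u by (auto simp: U_def b_def insert_commute)
    have nE: "{u, w} \<notin> E" using nr nb rb by blast
    have E': "insert {u, w} E \<subseteq> all_pairs V" using E uV u by (simp add: pair_in_all_pairs)
    have red: "({x, y} \<in> insert {u, w} E \<and> (col({u, w} := Blue)) {x, y} = Red) \<longleftrightarrow> r x y" for x y
      using nE by (auto simp: r_def)
    have blue: "({x, y} \<in> insert {u, w} E \<and> (col({u, w} := Blue)) {x, y} = Blue)
      \<longleftrightarrow> b x y \<or> {x, y} = {u, w}" for x y by (auto simp: b_def)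
    have "critical_colouring C4 K12 (V, insert {u, w} E) (col({u, w} := Blue))"
      unfolding critical_colouring_C4_K12_iff[OF E'] red blue
    proof (intro conjI allI impI)
      fix p q s t assume "r p q" "r q s" "r s t" "r t p"
      then show "p = s \<or> q = t" by (rule C4)
    next
      fix x y z assume "b x y \<or> {x, y} = {u, w}" "b x z \<or> {x, z} = {u, w}"
      then show "y = z" using b_unique nb by (auto simp: doubleton_eq_iff)
    qed
    then show False using ext[OF uV u(3) nE] by blast
  qed
  interpret red_blue V r b U
  proof
    show "finite V" "card V \<ge> 3" using fin n by (auto simp: G verts_def)
    show "\<not> r x x" for x using pair[of x x] by (auto simp: r_def)
    show "r y x" if "r x y" for x y using that by (simp add: r_def insert_commute)
    show "x \<in> V" if "r x y" for x y using that pair by (auto simp: r_def)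
    show "p = s \<or> q = t" if "r p q" "r q s" "r s t" "r t p" for p q s t using C4 that .
    show "y = z" if "b x y" "b x z" for x y z using b_unique that .
    show "b y x" if "b x y" for x y using that by (simp add: b_def insert_commute)
    show "U \<subseteq> V" "\<And>u x. u \<in> U \<Longrightarrow> \<not> b u x" by (auto simp: U_def)
    show "r u w" if "u \<in> U" "w \<in> U" "u \<noteq> w" for u w using clique that .
    show "\<exists>s t. r p s \<and> r s t \<and> r t q \<and> s \<noteq> q \<and> t \<noteq> p"
      if pq: "p \<in> V" "q \<in> V" "p \<noteq> q" and nr: "\<not> r p q" for p q
    proof -
      have "\<not> critical_colouring C4 K12 (V, insert {p, q} E) (col({p, q} := Red))"
      proof (cases "{p, q} \<in> E")
        case False
        then show ?thesis using ext[OF pq] by blast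
      next
        \<comment> \<open>Here \<open>pq\<close> is blue, and recolouring it red would contradict
          the minimal number of blue edges.\<close>
        case True
        then have "b p q" using nr rb by blast
        then have "{e \<in> E. (col({p, q} := Red)) e = Blue} \<subset> {e \<in> E. col e = Blue}"
          by (auto simp: b_def)
        then have "card {e \<in> E. (col({p, q} := Red)) e = Blue} < card {e \<in> E. col e = Blue}"
          by (rule psubset_card_mono[rotated]) (use finE in auto)
        then show ?thesis using least[of "col({p, q} := Red)"] True by (auto simp: insert_absorb)
      qed
      then show ?thesis
        using red_path_of_not_critical[OF E crit pq] nr unfolding r_def by blast
    qed
    show "\<exists>s t. r p s \<and> r s t \<and> r t q \<and> s \<noteq> q \<and> t \<noteq> p \<and>
        {p, s} \<noteq> {u, w} \<and> {s, t} \<noteq> {u, w} \<and> {t, q} \<noteq> {u, w}"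
      if u: "u \<in> U" "w \<in> U" "u \<noteq> w" and pq: "p \<in> V" "q \<in> V" "p \<noteq> q"
        and nr: "\<not> r p q" and nb: "\<not> b p q" for u w p q
    proof -
      have nE: "{p, q} \<notin> E" using nr nb rb by blast
      \<comment> \<open>This colouring is also critical: red only shrinks, and \<open>u\<close> and
        \<open>w\<close> were unmatched. Applying the path lemma to it yields a path that avoids
        \<open>uw\<close>.\<close>
      let ?c = "col({u, w} := Blue)"
      have nbu: "\<not> b u y" "\<not> b w y" "\<not> b y u" "\<not> b y w" for y
        using u by (auto simp: U_def b_def insert_commute)
      have red: "({x, y} \<in> E \<and> ?c {x, y} = Red) \<longleftrightarrow> r x y \<and> {x, y} \<noteq> {u, w}" for x y
        by (auto simp: r_def)
      have blue: "({x, y} \<in> E \<and> ?c {x, y} = Blue) \<longleftrightarrow> b x y \<or> {x, y} = {u, w}" for x y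
        using clique[OF u] by (auto simp: b_def r_def)
      have c: "critical_colouring C4 K12 (V, E) ?c"
        unfolding critical_colouring_C4_K12_iff[OF E] red blue
      proof (intro conjI allI impI)
        fix x y z assume "b x y \<or> {x, y} = {u, w}" "b x z \<or> {x, z} = {u, w}"
        then show "y = z" using b_unique nbu by (auto simp: doubleton_eq_iff)
      qed (use C4 in blast)
      have "\<not> (r p q \<and> {p, q} \<noteq> {u, w})" using nr by simp
      from red_path_of_not_critical[OF E c pq _ ext[OF pq nE], unfolded red, OF this]
      show ?thesis by (simp only: conj_assoc conj_left_commute conj_commute)
    qed
  qed
  \<comment> \<open>Four vertices of a red clique span a red C4.\<close>
  have cardU: "card U \<le> 3"
  proof (rule ccontr)
    assume "\<not> ?thesis"
    then obtain T where T: "T \<subseteq> U" "card T = Suc 3" using obtain_subset_with_card_n[of "Suc 3" U] by auto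
    then obtain u1 T' where T': "T = insert u1 T'" "u1 \<notin> T'" "card T' = 3"
      unfolding card_Suc_eq by blast
    then obtain u2 u3 u4 where u: "T' = {u2, u3, u4}" "u2 \<noteq> u3" "u2 \<noteq> u4" "u3 \<noteq> u4"
      by (auto simp: card_3_iff)
    have "u1 \<in> U" "u2 \<in> U" "u3 \<in> U" "u4 \<in> U" "u1 \<noteq> u2" "u1 \<noteq> u3" "u1 \<noteq> u4"
      using T T' u(1) by auto
    then show False
      using C4[of u1 u2 u3 u4] clique[of u1 u2] clique[of u2 u3] clique[of u3 u4] clique[of u4 u1] u
      by auto
  qed
  have deg: "card {y. {x, y} \<in> E} = card (N x) + (if x \<in> U then 0 else 1)" if x: "x \<in> V" for x
  proof -
    have finb: "finite {y. b x y}" by (rule finite_subset[OF _ fin]) (use pair rb in blast)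
    have "{y. {x, y} \<in> E} = N x \<union> {y. b x y}" using rb by auto
    then have "card {y. {x, y} \<in> E} = card (N x \<union> {y. b x y})" by (rule arg_cong)
    also have "\<dots> = card (N x) + card {y. b x y}"
      by (rule card_Un_disjoint) (use finb rb in auto)
    also have "card {y. b x y} = (if x \<in> U then 0 else 1)"
    proof (cases "x \<in> U")
      case False
      then obtain y where "b x y" using x by (auto simp: U_def)
      then have "{y. b x y} = {y}" using b_unique by blast
      then show ?thesis using False by simp
    qed (simp add: U_def)
    finally show ?thesis .
  qed
  have "2 * card E = (\<Sum>x\<in>V. card (N x) + (if x \<in> U then 0 else 1))"
    using sum_degrees[OF fin E] deg by simp
  also have "\<dots> = (\<Sum>x\<in>V. card (N x)) + card (V - U)"
  proof -
    have "(\<Sum>x\<in>V. if x \<in> U then 0 else 1) = (\<Sum>x\<in>V - U. 1::nat)"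
      by (rule sum.mono_neutral_cong_right) (use fin in auto)
    then show ?thesis by (simp add: sum.distrib)
  qed
  also have "card (V - U) = card V - card U"
    using U_V fin by (simp add: card_Diff_subset finite_subset)
  \<comment> \<open>The terms \<open>card U\<close> cancel and leave
    \<open>2 * card E + 7 \<ge> 4 * card V\<close>; parity improves the 7 to 6.\<close>
  finally show ?thesis
    using degree_sum_bound[OF cardU] card_mono[OF fin U_V] by (simp add: G verts_def edges_def)
qed

section \<open>Sharpness\<close>

lemma co_critical_C4_K12I:
  assumes "finite V" "E \<subseteq> all_pairs V" "critical_colouring C4 K12 (V, E) col"
    and "p \<in> V" "q \<in> V" "p \<noteq> q" "{p, q} \<notin> E"
    and ext: "\<And>x y c. x \<in> V \<Longrightarrow> y \<in> V \<Longrightarrow> x < y \<Longrightarrow> {x, y} \<notin> E \<Longrightarrow>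
      \<not> critical_colouring C4 K12 (V, insert {x, y} E) c"
  shows "co_critical C4 K12 (V :: nat set, E)"
proof -
  have "\<not> complete_graph (V, E)"
    using assms(4-7) by (auto simp: complete_graph_def verts_def edges_def pair_in_all_pairs)
  moreover have "\<not> (\<exists>c. critical_colouring C4 K12 (add_edge (V, E) e) c)"
    if "e \<in> edges (complement_graph (V, E))" for e
  proof -
    have e: "e \<in> all_pairs V" "e \<notin> E" using that by (auto simp: complement_graph_def edges_def verts_def)
    then have "card e = 2" by (simp add: all_pairs_def)
    then obtain x y where "e = {x, y}" "x \<noteq> y" unfolding card_2_iff by blast
    then obtain x y where xy: "e = {x, y}" "x < y" by (metis insert_commute linorder_neqE_nat)
    then show ?thesis using ext[of x y] e by (simp add: pair_in_all_pairs add_edge_def verts_def edges_def)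
  qed
  ultimately show ?thesis
    using assms(1-3) by (auto simp: co_critical_def simple_graph_def verts_def edges_def)
qed

text \<open>The blue edges form a matching, and K4 minus any matching contains a C4.\<close>

lemma not_critical_K4:
  assumes E: "E \<subseteq> all_pairs V" and ne: "distinct [a, b, c, d]"
    and e: "{a, b} \<in> E" "{a, c} \<in> E" "{a, d} \<in> E" "{b, c} \<in> E" "{b, d} \<in> E" "{c, d} \<in> E"
  shows "\<not> critical_colouring C4 K12 (V, E) col"
proof
  assume "critical_colouring C4 K12 (V, E) col"
  note C = this[unfolded critical_colouring_C4_K12_iff[OF E]]
  define r where "r x y \<longleftrightarrow> col {x, y} = Red" for x y
  have r: "col {x, y} = Red \<longleftrightarrow> r x y" "col {x, y} = Blue \<longleftrightarrow> \<not> r x y" for x y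
    by (cases "col {x, y}"; simp add: r_def)+
  have s: "r b a = r a b" "r c a = r a c" "r d a = r a d" "r c b = r b c" "r d b = r b d" "r d c = r c d"
    by (simp_all add: r_def insert_commute)
  have e': "{b, a} \<in> E" "{c, a} \<in> E" "{d, a} \<in> E" "{c, b} \<in> E" "{d, b} \<in> E" "{d, c} \<in> E"
    using e by (simp_all add: insert_commute)
  note red = C[THEN conjunct1, rule_format, unfolded r]
  note blue = C[THEN conjunct2, rule_format, unfolded r]
  note cyc = red[of a b c d] red[of a b d c] red[of a c b d]
  note pairs = blue[of a b c] blue[of a b d] blue[of a c d] blue[of b a c] blue[of b a d]
    blue[of b c d] blue[of c a b] blue[of c a d] blue[of c b d] blue[of d a b] blue[of d a c]
    blue[of d b c]
  show False using cyc pairs ne unfolding s by (simp add: e e') argo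
qed

text \<open>The wheel has hub \<open>h\<close> and rim \<open>x, y, y', x'\<close>. If a spoke
  \<open>hz\<close> is blue, the cycle through \<open>h\<close>, \<open>z\<close> and the two rim
  neighbours of \<open>z\<close> is red. If no spoke is blue, \<open>h, x, t, y\<close> makes
  \<open>tx\<close> or \<open>ty\<close> blue, say \<open>tx\<close>; then
  \<open>h, x, y, y'\<close> forces \<open>yy'\<close> and \<open>h, y', x', x\<close> forces
  \<open>x'y'\<close> to be blue, and these meet in \<open>y'\<close>.\<close>

lemma not_critical_wheel:
  assumes E: "E \<subseteq> all_pairs V" and ne: "distinct [h, x, y, x', y', t]"
    and e: "{h, x} \<in> E" "{h, y} \<in> E" "{h, x'} \<in> E" "{h, y'} \<in> E" "{x, y} \<in> E" "{x, x'} \<in> E"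
      "{y, y'} \<in> E" "{x', y'} \<in> E" "{t, x} \<in> E" "{t, y} \<in> E"
  shows "\<not> critical_colouring C4 K12 (V, E) col"
proof
  assume "critical_colouring C4 K12 (V, E) col"
  note C = this[unfolded critical_colouring_C4_K12_iff[OF E]]
  define r where "r x y \<longleftrightarrow> col {x, y} = Red" for x y
  have r: "col {x, y} = Red \<longleftrightarrow> r x y" "col {x, y} = Blue \<longleftrightarrow> \<not> r x y" for x y
    by (cases "col {x, y}"; simp add: r_def)+
  have s: "r x h = r h x" "r y h = r h y" "r x' h = r h x'" "r y' h = r h y'" "r y x = r x y"
    "r x' x = r x x'" "r y' y = r y y'" "r y' x' = r x' y'" "r x t = r t x" "r y t = r t y"
    by (simp_all add: r_def insert_commute)
  have e': "{x, h} \<in> E" "{y, h} \<in> E" "{x', h} \<in> E" "{y', h} \<in> E" "{y, x} \<in> E" "{x', x} \<in> E"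
    "{y', y} \<in> E" "{y', x'} \<in> E" "{x, t} \<in> E" "{y, t} \<in> E"
    using e by (simp_all add: insert_commute)
  note red = C[THEN conjunct1, rule_format, unfolded r]
  note blue = C[THEN conjunct2, rule_format, unfolded r]
  note cyc = red[of h x y y'] red[of h y y' x'] red[of h y' x' x] red[of h x' x y]
    red[of x y y' x'] red[of h x t y]
  note pairs = blue[of h x y] blue[of h x x'] blue[of h x y'] blue[of h y x'] blue[of h y y']
    blue[of h x' y'] blue[of x h y] blue[of x h x'] blue[of x y x'] blue[of x t h] blue[of x t y]
    blue[of x t x'] blue[of y h x] blue[of y h y'] blue[of y x y'] blue[of y t h] blue[of y t x]
    blue[of y t y'] blue[of x' h x] blue[of x' h y'] blue[of x' x y'] blue[of y' h y]
    blue[of y' h x'] blue[of y' y x'] blue[of t x y]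
  show False using cyc pairs ne unfolding s by (simp add: e e') argo
qed

text \<open>
  Two of the three edges \<open>pq\<close> are red, and then one of the two edges \<open>cq\<close> is blue; for that \<open>q\<close>
  there is a red cycle \<open>c, p, q, z\<close>.
\<close>
lemma not_critical_universal:
  assumes E: "E \<subseteq> all_pairs V" and univ: "\<And>x. x \<in> V \<Longrightarrow> x \<noteq> c \<Longrightarrow> {c, x} \<in> E"
    and p: "p \<noteq> c" and Q: "card Q = 3" "c \<notin> Q"
    and q: "\<And>q. q \<in> Q \<Longrightarrow> {p, q} \<in> E \<and> (\<exists>z. z \<noteq> p \<and> z \<noteq> c \<and> {q, z} \<in> E)"
  shows "\<not> critical_colouring C4 K12 (V, E) col"
proof
  assume "critical_colouring C4 K12 (V, E) col"
  note C = this[unfolded critical_colouring_C4_K12_iff[OF E]]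
  define r where "r x y \<longleftrightarrow> {x, y} \<in> E \<and> col {x, y} = Red" for x y
  define b where "b x y \<longleftrightarrow> {x, y} \<in> E \<and> col {x, y} = Blue" for x y
  have C4: "p = s \<or> q = t" if "r p q" "r q s" "r s t" "r t p" for p q s t
    using C[THEN conjunct1, rule_format, of p q s t] that by (simp add: r_def)
  have b_unique: "y = z" if "b x y" "b x z" for x y z
    using C[THEN conjunct2, rule_format, of x y z] that by (simp add: b_def)
  have sym: "r x y \<longleftrightarrow> r y x" "b x y \<longleftrightarrow> b y x" for x y by (simp_all add: r_def b_def insert_commute)
  have rb: "r x y \<or> b x y" if "{x, y} \<in> E" for x y
    using that by (cases "col {x, y}") (simp_all add: r_def b_def)
  have inV: "x \<in> V" "y \<in> V" if "{x, y} \<in> E" for x y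
    using subsetD[OF E that] by (simp_all add: pair_in_all_pairs)
  have red_c: "r c x" if "b c q" "x \<noteq> q" "x \<in> V" "x \<noteq> c" for q x
    using rb[OF univ[OF that(3,4)]] b_unique[OF that(1), of x] that(2) by blast
  have no: "\<not> b c q" if h: "q \<in> Q" "r p q" for q
  proof
    assume bq: "b c q"
    obtain z where z: "z \<noteq> p" "z \<noteq> c" "{q, z} \<in> E" and pq: "{p, q} \<in> E" using q[OF h(1)] by blast
    have "q \<noteq> p" "z \<noteq> q"
      using subsetD[OF E pq] subsetD[OF E z(3)] unfolding pair_in_all_pairs by auto
    then have "r c p" "r c z" using red_c[OF bq] inV[OF pq] inV[OF z(3)] p z by auto
    moreover have "r q z" using rb[OF z(3)] b_unique[of q c z] bq sym z(2) by blast
    ultimately have "c = q \<or> p = z" using C4[of c p q z] h(2) sym(1)[of c z] by blast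
    then show False using z(1) h(1) Q(2) by auto
  qed
  have red2: False if "q1 \<in> Q" "q2 \<in> Q" "q1 \<noteq> q2" "r p q1" "r p q2" for q1 q2
  proof -
    have "r c q" if h: "q \<in> Q" "r p q" for q
      using no[OF h] rb[OF univ[of q]] inV(2)[of p q] q[OF h(1)] h(1) Q(2) by auto
    then have "r c q1" "r c q2" using that by auto
    then have "c = p \<or> q1 = q2" using C4[of c q1 p q2] that(4,5) sym(1)[of p q1] sym(1)[of c q2] by blast
    then show False using p that(3) by auto
  qed
  obtain q1 q2 q3 where Q3: "Q = {q1, q2, q3}" "q1 \<noteq> q2" "q1 \<noteq> q3" "q2 \<noteq> q3"
    using Q(1) by (auto simp: card_3_iff)
  have "r p q1 \<or> b p q1" "r p q2 \<or> b p q2" "r p q3 \<or> b p q3" using q rb Q3(1) by auto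
  then show False
    using red2[of q1 q2] red2[of q1 q3] red2[of q2 q3] b_unique[of p q1 q2] b_unique[of p q1 q3]
      b_unique[of p q2 q3] Q3 by auto
qed

text \<open>Away from \<open>c\<close> the red edges form a matching, but every 4-cycle has a vertex
  other than \<open>c\<close> whose two neighbours on the cycle also differ from
  \<open>c\<close>.\<close>

lemma critical_universal:
  assumes E: "E \<subseteq> all_pairs V"
    and red: "\<And>x y z. {x, y} \<in> E \<Longrightarrow> col {x, y} = Red \<Longrightarrow> {x, z} \<in> E \<Longrightarrow> col {x, z} = Red \<Longrightarrow>
      x \<noteq> c \<Longrightarrow> y \<noteq> c \<Longrightarrow> z \<noteq> c \<Longrightarrow> y = z"
    and blue: "\<And>x y z. {x, y} \<in> E \<Longrightarrow> col {x, y} = Blue \<Longrightarrow> {x, z} \<in> E \<Longrightarrow> col {x, z} = Blue \<Longrightarrow> y = z"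
  shows "critical_colouring C4 K12 (V, E) col"
  unfolding critical_colouring_C4_K12_iff[OF E]
proof (intro conjI allI impI)
  fix p q s t
  define r where "r x y \<longleftrightarrow> {x, y} \<in> E \<and> col {x, y} = Red" for x y
  assume "{p, q} \<in> E \<and> col {p, q} = Red" "{q, s} \<in> E \<and> col {q, s} = Red"
    "{s, t} \<in> E \<and> col {s, t} = Red" "{t, p} \<in> E \<and> col {t, p} = Red"
  then have h: "r p q" "r q s" "r s t" "r t p" by (simp_all add: r_def)
  have sym: "r x y \<longleftrightarrow> r y x" for x y by (simp add: r_def insert_commute)
  have irr: "\<not> r x x" for x using E pair_in_all_pairs[of x x V] by (auto simp: r_def)
  have u: "y = z" if "r x y" "r x z" "x \<noteq> c" "y \<noteq> c" "z \<noteq> c" for x y z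
    using red[of x y z] that by (simp add: r_def)
  show "p = s \<or> q = t"
  proof (cases "q = c \<or> t = c")
    case False
    then show ?thesis using h u[of p q t] u[of s q t] sym[of t p] sym[of q s] by blast
  next
    case True
    then have "p \<noteq> c" "s \<noteq> c" using h irr sym by blast+
    then show ?thesis using h u[of q p s] u[of t p s] sym[of p q] sym[of s t] True by blast
  qed
qed (use blue in blast)

text \<open>Each vertex of a red C4 has two red neighbours and hence lies in \<open>S\<close>, which
  has too few vertices.\<close>

lemma critical_small_core:
  assumes E: "E \<subseteq> all_pairs V" and S: "finite S" "card S \<le> 3"
    and red: "\<And>x y z. {x, y} \<in> E \<Longrightarrow> col {x, y} = Red \<Longrightarrow> {x, z} \<in> E \<Longrightarrow> col {x, z} = Red \<Longrightarrow>
      x \<notin> S \<Longrightarrow> y = z"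
    and blue: "\<And>x y z. {x, y} \<in> E \<Longrightarrow> col {x, y} = Blue \<Longrightarrow> {x, z} \<in> E \<Longrightarrow> col {x, z} = Blue \<Longrightarrow> y = z"
  shows "critical_colouring C4 K12 (V, E) col"
  unfolding critical_colouring_C4_K12_iff[OF E]
proof (intro conjI allI impI)
  fix p q s t
  define r where "r x y \<longleftrightarrow> {x, y} \<in> E \<and> col {x, y} = Red" for x y
  assume "{p, q} \<in> E \<and> col {p, q} = Red" "{q, s} \<in> E \<and> col {q, s} = Red"
    "{s, t} \<in> E \<and> col {s, t} = Red" "{t, p} \<in> E \<and> col {t, p} = Red"
  then have h: "r p q" "r q s" "r s t" "r t p" by (simp_all add: r_def)
  have sym: "r x y \<longleftrightarrow> r y x" for x y by (simp add: r_def insert_commute)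
  have irr: "\<not> r x x" for x using E pair_in_all_pairs[of x x V] by (auto simp: r_def)
  have u: "y = z" if "r x y" "r x z" "x \<notin> S" for x y z
    using red[of x y z] that by (simp add: r_def)
  show "p = s \<or> q = t"
  proof (rule ccontr)
    assume ne: "\<not> ?thesis"
    then have "{p, q, s, t} \<subseteq> S"
      using h u[of p q t] u[of q p s] u[of s q t] u[of t s p] sym[of t p] sym[of p q] sym[of q s]
        sym[of s t] by blast
    then have "card {p, q, s, t} \<le> 3" using card_mono[OF S(1)] S(2) le_trans by blast
    moreover have "p \<noteq> q" "q \<noteq> s" "s \<noteq> t" "t \<noteq> p" using h irr by blast+
    ultimately show False using ne by simp
  qed
qed (use blue in blast)

section \<open>The extremal graphs\<close>

lemma sharp_5: "\<exists>G :: nat graph. co_critical C4 K12 G \<and> card (verts G) = 5 \<and> card (edges G) = 7"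
proof -
  define V where "V = {0, 1, 2, 3, 4::nat}"
  define E where "E = {{0, 1}, {0, 2}, {0, 3}, {0, 4}, {1, 2}, {1, 3}, {1, 4::nat}}"
  define col where "col = (\<lambda>e. if e = {0, 3} \<or> e = {1, 2::nat} then Blue else Red)"
  have E: "E \<subseteq> all_pairs V" by (simp add: E_def V_def pair_in_all_pairs)
  have K: "\<not> critical_colouring C4 K12 (V, insert {x, y} E) c"
    if h: "x \<in> V" "y \<in> V" "x < y" "{x, y} \<notin> E" for x y c
  proof -
    have E': "insert {x, y} E \<subseteq> all_pairs V" using E h by (simp add: pair_in_all_pairs)
    \<comment> \<open>Every non-edge joins two of the vertices 2, 3, 4; adding it completes a K4
      with 0 and 1.\<close>
    consider "x = 2" "y = 3" | "x = 2" "y = 4" | "x = 3" "y = 4"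
      using h unfolding V_def by (elim insertE) (simp_all add: E_def doubleton_eq_iff)
    then show ?thesis
    proof cases
      case 1
      then show ?thesis by (intro not_critical_K4[OF E', of 0 1 2 3]) (simp_all add: E_def doubleton_eq_iff)
    next
      case 2
      then show ?thesis by (intro not_critical_K4[OF E', of 0 1 2 4]) (simp_all add: E_def doubleton_eq_iff)
    next
      case 3
      then show ?thesis by (intro not_critical_K4[OF E', of 0 1 3 4]) (simp_all add: E_def doubleton_eq_iff)
    qed
  qed
  have "critical_colouring C4 K12 (V, E) col"
  proof (rule critical_small_core[OF E, of "{0, 1, 4}"])
    have R: "e \<in> E \<Longrightarrow> col e = Red \<Longrightarrow> e \<in> {{0, 1}, {0, 2}, {0, 4}, {1, 3}, {1, 4}}" for e
      unfolding E_def by (elim insertE) (simp_all add: col_def doubleton_eq_iff)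
    have r: "{x, y} \<in> {{0, 1}, {0, 2}, {0, 4}, {1, 3}, {1, 4}}" if "{x, y} \<in> E" "col {x, y} = Red" for x y
      by (rule R[OF that])
    fix x y z assume "{x, y} \<in> E" "col {x, y} = Red" "{x, z} \<in> E" "col {x, z} = Red" "x \<notin> {0, 1, 4}"
    then show "y = z" using r[of x y] r[of x z] by (auto simp: doubleton_eq_iff)
  next
    have B: "e \<in> E \<Longrightarrow> col e = Blue \<Longrightarrow> e \<in> {{0, 3}, {1, 2}}" for e
      by (simp add: col_def split: if_splits)
    have b: "{x, y} \<in> {{0, 3}, {1, 2}}" if "{x, y} \<in> E" "col {x, y} = Blue" for x y
      by (rule B[OF that])
    fix x y z assume "{x, y} \<in> E" "col {x, y} = Blue" "{x, z} \<in> E" "col {x, z} = Blue"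
    then show "y = z" using b[of x y] b[of x z] by (auto simp: doubleton_eq_iff)
  qed simp_all
  then have "co_critical C4 K12 (V, E)"
  proof (rule co_critical_C4_K12I[OF _ E, rotated])
    show "\<not> critical_colouring C4 K12 (V, insert {x, y} E) c"
      if "x \<in> V" "y \<in> V" "x < y" "{x, y} \<notin> E" for x y c using K[OF that] .
    show "{2, 3} \<notin> E" by (auto simp: E_def doubleton_eq_iff)
  qed (simp_all add: V_def)
  moreover have "card V = 5" "card E = 7" by (simp_all add: V_def E_def doubleton_eq_iff)
  ultimately show ?thesis unfolding verts_def edges_def by (metis fst_conv snd_conv)
qed

text \<open>The triangle is 0, 1, 2 and the outer vertices are 3, 4, 5. Joining an outer vertex to
  the opposite triangle vertex gives a K4; joining two outer vertices gives a wheel around their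
  common neighbour, with the third outer vertex as \<open>t\<close>.\<close>

lemma sharp_6: "\<exists>G :: nat graph. co_critical C4 K12 G \<and> card (verts G) = 6 \<and> card (edges G) = 9"
proof -
  define V where "V = {0, 1, 2, 3, 4, 5::nat}"
  define E where "E = {{0, 1}, {0, 2}, {1, 2}, {0, 3}, {1, 3}, {0, 4}, {2, 4}, {1, 5}, {2, 5::nat}}"
  define col where "col = (\<lambda>e. if e = {0, 3} \<or> e = {1, 5::nat} \<or> e = {2, 4} then Blue else Red)"
  have E: "E \<subseteq> all_pairs V" by (simp add: E_def V_def pair_in_all_pairs)
  have K: "\<not> critical_colouring C4 K12 (V, insert {x, y} E) c"
    if h: "x \<in> V" "y \<in> V" "x < y" "{x, y} \<notin> E" for x y c
  proof -
    have E': "insert {x, y} E \<subseteq> all_pairs V" using E h by (simp add: pair_in_all_pairs)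
    consider "x = 2" "y = 3" | "x = 1" "y = 4" | "x = 0" "y = 5"
      | "x = 3" "y = 4" | "x = 3" "y = 5" | "x = 4" "y = 5"
      using h unfolding V_def by (elim insertE) (simp_all add: E_def doubleton_eq_iff)
    then show ?thesis
    proof cases
      case 1
      then show ?thesis by (intro not_critical_K4[OF E', of 0 1 2 3]) (simp_all add: E_def doubleton_eq_iff)
    next
      case 2
      then show ?thesis by (intro not_critical_K4[OF E', of 0 1 2 4]) (simp_all add: E_def doubleton_eq_iff)
    next
      case 3
      then show ?thesis by (intro not_critical_K4[OF E', of 0 1 2 5]) (simp_all add: E_def doubleton_eq_iff)
    next
      case 4
      then show ?thesis by (intro not_critical_wheel[OF E', of 0 1 2 3 4 5]) (simp_all add: E_def doubleton_eq_iff)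
    next
      case 5
      then show ?thesis by (intro not_critical_wheel[OF E', of 1 0 2 3 5 4]) (simp_all add: E_def doubleton_eq_iff)
    next
      case 6
      then show ?thesis by (intro not_critical_wheel[OF E', of 2 0 1 4 5 3]) (simp_all add: E_def doubleton_eq_iff)
    qed
  qed
  have "critical_colouring C4 K12 (V, E) col"
  proof (rule critical_small_core[OF E, of "{0, 1, 2}"])
    have R: "e \<in> E \<Longrightarrow> col e = Red \<Longrightarrow> e \<in> {{0, 1}, {0, 2}, {1, 2}, {0, 4}, {1, 3}, {2, 5}}" for e
      unfolding E_def by (elim insertE) (simp_all add: col_def doubleton_eq_iff)
    have r: "{x, y} \<in> {{0, 1}, {0, 2}, {1, 2}, {0, 4}, {1, 3}, {2, 5}}" if "{x, y} \<in> E" "col {x, y} = Red" for x y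
      by (rule R[OF that])
    fix x y z assume "{x, y} \<in> E" "col {x, y} = Red" "{x, z} \<in> E" "col {x, z} = Red" "x \<notin> {0, 1, 2}"
    then show "y = z" using r[of x y] r[of x z] by (auto simp: doubleton_eq_iff)
  next
    have B: "e \<in> E \<Longrightarrow> col e = Blue \<Longrightarrow> e \<in> {{0, 3}, {1, 5}, {2, 4}}" for e
      by (simp add: col_def split: if_splits)
    have b: "{x, y} \<in> {{0, 3}, {1, 5}, {2, 4}}" if "{x, y} \<in> E" "col {x, y} = Blue" for x y
      by (rule B[OF that])
    fix x y z assume "{x, y} \<in> E" "col {x, y} = Blue" "{x, z} \<in> E" "col {x, z} = Blue"
    then show "y = z" using b[of x y] b[of x z] by (auto simp: doubleton_eq_iff)
  qed simp_all
  then have "co_critical C4 K12 (V, E)"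
  proof (rule co_critical_C4_K12I[OF _ E, rotated])
    show "\<not> critical_colouring C4 K12 (V, insert {x, y} E) c"
      if "x \<in> V" "y \<in> V" "x < y" "{x, y} \<notin> E" for x y c using K[OF that] .
    show "{2, 3} \<notin> E" by (auto simp: E_def doubleton_eq_iff)
  qed (simp_all add: V_def)
  moreover have "card V = 6" "card E = 9" by (simp_all add: V_def E_def doubleton_eq_iff)
  ultimately show ?thesis unfolding verts_def edges_def by (metis fst_conv snd_conv)
qed

text \<open>Vertex 0 is universal, \<open>1, ..., m\<close> is the path and
  \<open>m + 1, ..., n - 1\<close> the cycle; \<open>m\<close> is chosen by parity so that the cycle
  has even length and its edges can alternate in colour.\<close>

lemma sharp_ge_7:
  assumes n: "n \<ge> 7"
  shows "\<exists>G :: nat graph. co_critical C4 K12 G \<and> card (verts G) = n \<and> card (edges G) = 2 * n - 3"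
proof -
  define m :: nat where "m = (if odd n then 2 else 3)"
  define V where "V = {..<n}"
  define H where "H x y \<longleftrightarrow> (0 < x \<and> y = x + 1 \<and> x \<noteq> m \<and> y < n) \<or> (x = m + 1 \<and> y = n - 1)" for x y
  define E0 where "E0 = (\<lambda>i. {0, i}) ` {1..<n}"
  define E1 where "E1 = (\<lambda>i. {i, i + 1}) ` ({1..<n - 1} - {m})"
  define E where "E = E0 \<union> E1 \<union> {{m + 1, n - 1}}"
  \<comment> \<open>All edges at 0 are red, whence the condition \<open>i>0\<close>. Along path and
    cycle the colours alternate; the closing edge of the cycle is blue exactly for odd
    \<open>n\<close>.\<close>
  define col where "col = (\<lambda>e. if (\<exists>i>0. even i \<and> e = {i, i + 1}) \<or> (odd n \<and> e = {3, n - 1})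
    then Blue else Red)"
  have m: "m = 2 \<or> m = 3" by (simp add: m_def)
  have E_iff: "{x, y} \<in> E \<longleftrightarrow>
      (x = 0 \<and> 0 < y \<and> y < n) \<or> (y = 0 \<and> 0 < x \<and> x < n) \<or> H x y \<or> H y x" for x y
  proof -
    have "{x, y} \<in> E0 \<longleftrightarrow> (x = 0 \<and> 0 < y \<and> y < n) \<or> (y = 0 \<and> 0 < x \<and> x < n)"
      by (auto simp: E0_def doubleton_eq_iff image_iff)
    moreover have "{x, y} \<in> E1 \<longleftrightarrow> (0 < x \<and> y = x + 1 \<and> x \<noteq> m \<and> y < n) \<or> (0 < y \<and> x = y + 1 \<and> y \<noteq> m \<and> x < n)"
      by (auto simp: E1_def doubleton_eq_iff image_iff)
    ultimately show ?thesis by (auto simp: E_def H_def doubleton_eq_iff)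
  qed
  have E: "E \<subseteq> all_pairs V"
    using n m by (auto simp: E_def E0_def E1_def V_def pair_in_all_pairs)
  have H_pos: "0 < x" "0 < y" "x < n" "y < n" if "H x y" for x y using that n m by (auto simp: H_def)
  have blue_iff: "col {x, y} = Blue \<longleftrightarrow> (0 < x \<and> even x \<and> y = x + 1) \<or> (0 < y \<and> even y \<and> x = y + 1) \<or>
      (odd n \<and> (x = 3 \<and> y = n - 1 \<or> y = 3 \<and> x = n - 1))" for x y
    by (auto simp: col_def doubleton_eq_iff)
  \<comment> \<open>\<open>pr\<close> and \<open>pb\<close> give the only candidate for a red and
    for a blue neighbour other than 0, which makes both colours matchings away from 0. At an end of
    the path the formula may name a non-neighbour.\<close>
  define pr where "pr x = (if even n \<and> x = 4 then n - 1 else if even n \<and> x = n - 1 then 4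
    else if odd x then x + 1 else x - 1)" for x
  define pb where "pb x = (if odd n \<and> x = 3 then n - 1 else if odd n \<and> x = n - 1 then 3
    else if even x then x + 1 else x - 1)" for x
  have H_red: "y = pr x \<and> x = pr y" if H: "H x y" and nb: "col {x, y} \<noteq> Blue" for x y
  proof -
    consider "0 < x" "y = x + 1" "x \<noteq> m" "y < n" | "x = m + 1" "y = n - 1" using H by (auto simp: H_def)
    then show ?thesis
    proof cases
      case 1
      then have "odd x" using nb unfolding blue_iff by auto
      moreover have "even n \<Longrightarrow> x \<noteq> 3" using 1 by (simp add: m_def)
      moreover have "x \<noteq> n - 1" using 1 by simp
      moreover have "even n \<Longrightarrow> y \<noteq> n - 1" using \<open>odd x\<close> 1(2) n by presburger
      ultimately show ?thesis using 1 unfolding pr_def by auto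
    next
      case 2
      have "even n"
      proof (rule ccontr)
        assume "odd n"
        moreover from this have "m = 2" by (simp add: m_def)
        ultimately show False using nb 2 unfolding blue_iff by simp
      qed
      moreover from this have "m = 3" by (simp add: m_def)
      ultimately show ?thesis using 2 unfolding pr_def by simp
    qed
  qed
  have H_blue: "y = pb x \<and> x = pb y" if H: "H x y" and bl: "col {x, y} = Blue" for x y
  proof -
    consider "0 < x" "y = x + 1" "x \<noteq> m" "y < n" | "x = m + 1" "y = n - 1" using H by (auto simp: H_def)
    then show ?thesis
    proof cases
      case 1
      have "\<not> (odd n \<and> x = 3 \<and> x + 1 = n - 1)" "\<not> (odd n \<and> x + 1 = 3 \<and> x = n - 1)" using n by auto
      then have "even x" using bl 1 unfolding blue_iff by auto
      moreover have "odd n \<Longrightarrow> y \<noteq> 3" using 1 by (simp add: m_def)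
      moreover have "x \<noteq> n - 1" using 1 by simp
      moreover have "odd n \<Longrightarrow> y \<noteq> n - 1" using \<open>even x\<close> 1(2) n by presburger
      ultimately show ?thesis using 1 unfolding pb_def by auto
    next
      case 2
      have "m + 1 \<noteq> n" "n - 1 \<noteq> m + 1 + 1" "m + 1 \<noteq> n - 1 + 1" using n m by auto
      then have "odd n"
        using bl 2 n unfolding blue_iff by (cases "even n") (auto simp: m_def)
      moreover from this have "m = 2" by (simp add: m_def)
      ultimately show ?thesis using 2 unfolding pb_def by simp
    qed
  qed
  have crit: "critical_colouring C4 K12 (V, E) col"
  proof (rule critical_universal[OF E, of _ 0])
    fix x y z assume h: "{x, y} \<in> E" "col {x, y} = Red" "{x, z} \<in> E" "col {x, z} = Red"
      "x \<noteq> 0" "y \<noteq> 0" "z \<noteq> 0"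
    have "w = pr x" if w: "{x, w} \<in> E" "col {x, w} = Red" "w \<noteq> 0" for w
    proof -
      have "H x w \<or> H w x" using w h(5) by (auto simp: E_iff)
      then show ?thesis using H_red[of x w] H_red[of w x] w(2) by (auto simp: insert_commute)
    qed
    then show "y = z" using h by metis
  next
    fix x y z assume h: "{x, y} \<in> E" "col {x, y} = Blue" "{x, z} \<in> E" "col {x, z} = Blue"
    have "w = pb x" if w: "{x, w} \<in> E" "col {x, w} = Blue" for w
    proof -
      have "x \<noteq> 0" "w \<noteq> 0" using w(2) n unfolding blue_iff by auto
      then have "H x w \<or> H w x" using w(1) by (auto simp: E_iff)
      then show ?thesis using H_blue[of x w] H_blue[of w x] w(2) by (auto simp: insert_commute)
    qed
    then show "y = z" using h by metis
  qed
  have cycle: "\<exists>q1 q2. q1 \<noteq> q2 \<and> q1 \<noteq> 0 \<and> q2 \<noteq> 0 \<and> m < q1 \<and> m < q2 \<and> {x, q1} \<in> E \<and> {x, q2} \<in> E"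
    if "m < x" "x < n" for x
  proof -
    define q1 where "q1 = (if x = n - 1 then m + 1 else x + 1)"
    define q2 where "q2 = (if x = m + 1 then n - 1 else x - 1)"
    have "H x q1 \<or> H q1 x"
      using that unfolding q1_def H_def by (cases "x = n - 1") auto
    then have "{x, q1} \<in> E" using E_iff by blast
    moreover have "H x q2 \<or> H q2 x"
      using that m unfolding q2_def H_def by (cases "x = m + 1") auto
    then have "{x, q2} \<in> E" using E_iff by blast
    moreover have "q1 \<noteq> q2" "m < q1" "m < q2"
      using that n m by (auto simp: q1_def q2_def)
    ultimately show ?thesis by (intro exI[of _ q1] exI[of _ q2]) simp
  qed
  have some_nbr: "\<exists>z. z \<noteq> 0 \<and> {y, z} \<in> E" if y: "0 < y" "y < n" for y
  proof (cases "m < y")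
    case True
    then show ?thesis using cycle y by blast
  next
    case False
    consider "y = 1" | "y = 2" | "y = 3" "m = 3" using False y m by linarith
    then show ?thesis
    proof cases
      case 1
      then have "{y, 2} \<in> E" using n m by (auto simp: E_iff H_def)
      then show ?thesis by (intro exI[of _ 2]) simp
    next
      case 2
      then have "{y, 1} \<in> E" using n m by (auto simp: E_iff H_def)
      then show ?thesis by (intro exI[of _ 1]) simp
    next
      case 3
      then have "{y, 2} \<in> E" using n by (auto simp: E_iff H_def)
      then show ?thesis by (intro exI[of _ 2]) simp
    qed
  qed
  \<comment> \<open>The new edge gives the cycle vertex \<open>x\<close> a third neighbour besides
    0, so \<open>not_critical_universal\<close> applies with centre 0 and the two cycle neighbours
    of \<open>x\<close> together with \<open>y\<close>.\<close>
  have on_cycle: "\<not> critical_colouring C4 K12 (V, insert {x, y} E) c"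
    if x: "m < x" "x < n" and y: "y < n" "x \<noteq> y" "{x, y} \<notin> E" for x y c
  proof -
    have E': "insert {x, y} E \<subseteq> all_pairs V" using E x y by (simp add: pair_in_all_pairs V_def)
    have y0: "0 < y" using x y by (auto simp: E_iff)
    obtain q1 q2 where q: "q1 \<noteq> q2" "q1 \<noteq> 0" "q2 \<noteq> 0" "m < q1" "m < q2" "{x, q1} \<in> E" "{x, q2} \<in> E"
      using cycle[OF x] by blast
    have two: "\<exists>z. z \<noteq> x \<and> z \<noteq> 0 \<and> {q, z} \<in> insert {x, y} E" if h: "m < q" "{x, q} \<in> E" for q
    proof -
      have "q < n" using subsetD[OF E h(2)] by (simp add: pair_in_all_pairs V_def)
      then obtain z1 z2 where "z1 \<noteq> z2" "z1 \<noteq> 0" "z2 \<noteq> 0" "{q, z1} \<in> E" "{q, z2} \<in> E"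
        using cycle[OF h(1)] by blast
      then show ?thesis by (cases "z1 = x") auto
    qed
    have yz: "\<exists>z. z \<noteq> x \<and> z \<noteq> 0 \<and> {y, z} \<in> insert {x, y} E"
    proof -
      obtain z where z: "z \<noteq> 0" "{y, z} \<in> E" using some_nbr[OF y0 y(1)] by blast
      then have "z \<noteq> x" using y(3) by (auto simp: insert_commute)
      then show ?thesis using z by auto
    qed
    have ne: "q1 \<noteq> y" "q2 \<noteq> y" using q y(3) by auto
    show ?thesis
    proof (rule not_critical_universal[OF E', of 0 x "{q1, q2, y}"])
      show "{0, v} \<in> insert {x, y} E" if "v \<in> V" "v \<noteq> 0" for v
        using that by (simp add: E_iff V_def)
      show "x \<noteq> 0" using x by simp
      show "card {q1, q2, y} = 3" "0 \<notin> {q1, q2, y}" using q ne y0 by auto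
      show "{x, q} \<in> insert {x, y} E \<and> (\<exists>z. z \<noteq> x \<and> z \<noteq> 0 \<and> {q, z} \<in> insert {x, y} E)"
        if h: "q \<in> {q1, q2, y}" for q
      proof -
        consider "q = q1" | "q = q2" | "q = y" using h by blast
        then show ?thesis using two[OF q(4,6)] two[OF q(5,7)] yz q(6,7) by cases simp_all
      qed
    qed
  qed
  have "co_critical C4 K12 (V, E)"
  proof (rule co_critical_C4_K12I[OF _ E crit, of 1 5])
    show "finite V" "1 \<in> V" "5 \<in> V" "(1::nat) \<noteq> 5" using n by (simp_all add: V_def)
    show "{1, 5} \<notin> E" using n m by (auto simp: E_iff H_def)
    show "\<not> critical_colouring C4 K12 (V, insert {x, y} E) c"
      if h: "x \<in> V" "y \<in> V" "x < y" "{x, y} \<notin> E" for x y c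
    proof (cases "m < y")
      case True
      then show ?thesis using on_cycle[of y x c] h by (simp add: V_def insert_commute)
    next
      case False
      have "0 < x" using h by (auto simp: E_iff V_def)
      moreover have "\<not> H x y" using h by (simp add: E_iff)
      \<comment> \<open>Both ends lie on the path, whose only non-edge is \<open>{1, 3}\<close>, and
        only when it has three vertices.\<close>
      ultimately have xy: "x = 1" "y = 3" "m = 3" using False h(3) m n by (auto simp: H_def)
      have E': "insert {1, 3} E \<subseteq> all_pairs V" using E n by (simp add: pair_in_all_pairs V_def)
      have "\<not> critical_colouring C4 K12 (V, insert {1, 3} E) c"
        by (rule not_critical_K4[OF E', of 0 1 2 3]) (use n xy(3) in \<open>simp_all add: E_iff H_def\<close>)
      then show ?thesis using xy by simp
    qed
  qed
  moreover have "card E = 2 * n - 3"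
  proof -
    have "inj_on (\<lambda>i. {0, i}) {1..<n}" by (auto simp: inj_on_def doubleton_eq_iff)
    then have c0: "card E0 = n - 1" by (simp add: E0_def card_image)
    have "inj_on (\<lambda>i. {i, i + 1}) ({1..<n - 1} - {m})" by (auto simp: inj_on_def doubleton_eq_iff)
    moreover have "card ({1..<n - 1} - {m}) = n - 1 - 1 - 1"
      using n m by (subst card_Diff_singleton) auto
    \<comment> \<open>Out of the \<open>n - 2\<close> consecutive pairs only the gap between path
      and cycle at \<open>m\<close> is missing.\<close>
    ultimately have c1: "card E1 = n - 3" by (simp add: E1_def card_image)
    have fin: "finite E0" "finite E1" by (simp_all add: E0_def E1_def)
    have zero: "0 \<in> e" if "e \<in> E0" for e using that unfolding E0_def by blast
    have nzero: "0 \<notin> e" if "e \<in> E1" for e using that unfolding E1_def by auto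
    have "card (E0 \<union> E1) = card E0 + card E1"
      by (rule card_Un_disjoint[OF fin]) (use zero nzero in blast)
    moreover have "{m + 1, n - 1} \<notin> E0" using zero[of "{m + 1, n - 1}"] n by auto
    moreover have "{m + 1, n - 1} \<notin> E1"
    proof
      assume "{m + 1, n - 1} \<in> E1"
      then obtain i where i: "i \<in> {1..<n - 1}" "{m + 1, n - 1} = {i, i + 1}"
        unfolding E1_def by blast
      then have "n - 1 = m + 2" unfolding doubleton_eq_iff by auto
      then show False using n m by auto
    qed
    moreover have "E = insert {m + 1, n - 1} (E0 \<union> E1)" by (simp add: E_def)
    ultimately show ?thesis using n c0 c1 fin by simp
  qed
  ultimately show ?thesis by (intro exI[of _ "(V, E)"]) (simp add: verts_def edges_def V_def)
qed

theorem theorem1p5: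
  shows "(\<forall>n \<ge> 5. \<forall>G :: 'a graph.
            co_critical C4 K12 G \<and> card (verts G) = n \<longrightarrow> card (edges G) \<ge> 2 * n - 3)
       \<and> (\<forall>n \<ge> 5. \<exists>G :: nat graph.
            co_critical C4 K12 G \<and> card (verts G) = n \<and> card (edges G) = 2 * n - 3)"
proof (intro conjI allI impI)
  fix n :: nat and G :: "'a graph"
  assume "n \<ge> 5" "co_critical C4 K12 G \<and> card (verts G) = n"
  then show "card (edges G) \<ge> 2 * n - 3"
    using co_critical_C4_K12_lower_bound[of G] by auto
next
  fix n :: nat assume "n \<ge> 5"
  then consider "n = 5" | "n = 6" | "n \<ge> 7" by linarith
  then show "\<exists>G :: nat graph. co_critical C4 K12 G \<and> card (verts G) = n \<and> card (edges G) = 2 * n - 3"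
    using sharp_5 sharp_6 sharp_ge_7 by cases simp_all
qed

end
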